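(* Let $1\le s<t$ be fixed integers. There exists $N=N(s,t)$ such that for all $n\ge N$, $$\operatorname{sat}(K_{n,n},K_{s,t})\ge (s+t-2)n-(t-1)(t-2)-\left\lfloor \frac{(s-1)^2}{4}\right\rfloor.$$
   Context: An $n$ by $n$ bipartite graph $G$ has two color classes $U,U'$ with $|U|=|U'|=n$. Such a $G$ is called $K_{s,t}$-saturated if $G$ contains no subgraph isomorphic to $K_{s,t}$ (with either side of $K_{s,t}$ lying in either class), but adding any missing edge $uu'$ with $u\in U$, $u'\in U'$ creates a subgraph isomorphic to $K_{s,t}$ (with either orientation). $\operatorname{sat}(K_{n,n},K_{s,t})$ denotes the minimum number of edges of a $K_{s,t}$-saturated $n$ by $n$ bipartite graph. *)

theory Defs
  imports Main
begin

text \<open>An n by n bipartite graph: colour classes U = {0..<n} and U' = {0..<n}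
  (two disjoint copies), edges given as a set of pairs (u,u') with u in U, u' in U'.\<close>

definition bip_graph :: "nat \<Rightarrow> (nat \<times> nat) set \<Rightarrow> bool" where
  "bip_graph n E \<longleftrightarrow> E \<subseteq> {0..<n} \<times> {0..<n}"

definition contains_Kst :: "nat \<Rightarrow> nat \<Rightarrow> nat \<Rightarrow> (nat \<times> nat) set \<Rightarrow> bool" where
  "contains_Kst n s t E \<longleftrightarrow>
     (\<exists>A B. A \<subseteq> {0..<n} \<and> B \<subseteq> {0..<n} \<and>
        ((card A = s \<and> card B = t) \<or> (card A = t \<and> card B = s)) \<and> A \<times> B \<subseteq> E)"

definition Kst_saturated :: "nat \<Rightarrow> nat \<Rightarrow> nat \<Rightarrow> (nat \<times> nat) set \<Rightarrow> bool" where
  "Kst_saturated n s t E \<longleftrightarrow> bip_graph n E \<and> \<not> contains_Kst n s t E \<and>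
     (\<forall>u \<in> {0..<n}. \<forall>v \<in> {0..<n}. (u, v) \<notin> E \<longrightarrow> contains_Kst n s t (insert (u, v) E))"

definition sat_bip :: "nat \<Rightarrow> nat \<Rightarrow> nat \<Rightarrow> nat" where
  "sat_bip n s t = Inf (card ` {E. Kst_saturated n s t E})"

end

(* If some vertex u has degree at most t - 2, every copy of K_{s,t} created at a missing edge uv
   uses u on the side of size t, and counting edges through N(u) gives the bound. So let all degrees
   be at least t - 1. A core is a complete pair of sets F, G of size s - 1, one in each class, such
   that every other vertex is joined to the opposite core set or is rich, i.e. has t - 1 neighbours
   joined to its own core set. Counting edges by degrees outside F and by incidence with F gives
   (s+t-2)n - (s-1)(t-1) up to the loss at the vertices that are not joined to F. Vertices of
   positive loss in the two classes are pairwise adjacent, for a copy of K_{s,t} at a missing edge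
   between them would make one of its non-rich vertices rich; hence x and z of them lose at most
   min(x(s-1-z), z(s-1-x)) <= (s-1)^2/4.

   For large n with at most (s+t-2)n edges a core is found among the vertices of high degree. The copy
   of K_{s,t} at a missing edge uv contains a path u - T - S - v, and v is out of reach of u through low
   vertices unless it is one of boundedly many, so T or S consists of high vertices. If almost all
   vertices of both classes have s - 1 high neighbours, then almost all of them have degree t - 1 and
   exactly s - 1 high neighbours, which are the same for almost all vertices of one class. If many
   vertices of one class have fewer high neighbours, then almost all vertices of the other class are
   joined to one fixed set of size s - 1, and all vertices outside this set are rich. *)

theory Submission
  imports Defs
begin

subsection \<open>Saturated graphs and vertices of small degree\<close>

definition nbr :: "(nat \<times> nat) set \<Rightarrow> nat \<Rightarrow> nat set" where
  "nbr E u = E `` {u}"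

text \<open>The common neighbourhood of \<open>G\<close>. With the bound \<open>v < n\<close> it is
  the whole opposite class when \<open>G\<close> is empty, as happens for core sets if
  \<open>s = 1\<close>.\<close>

definition cnb :: "nat \<Rightarrow> (nat \<times> nat) set \<Rightarrow> nat set \<Rightarrow> nat set" where
  "cnb n E G = {v. v < n \<and> G \<times> {v} \<subseteq> E}"

lemma mem_nbr [simp]: "v \<in> nbr E u \<longleftrightarrow> (u, v) \<in> E"
  by (simp add: nbr_def)

lemma finite_cnb [simp]: "finite (cnb n E G)"
  by (simp add: cnb_def)

lemma cnb_lessThan: "cnb n E G \<subseteq> {..<n}"
  by (auto simp: cnb_def)

lemma double_count:
  assumes "finite A" "finite B"
  shows "(\<Sum>u\<in>A. card (nbr E u \<inter> B)) = (\<Sum>v\<in>B. card (nbr (E\<inverse>) v \<inter> A))"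
proof -
  have "nbr E u \<inter> B = {v \<in> B. (u, v) \<in> E}" "nbr (E\<inverse>) v \<inter> A = {u \<in> A. (u, v) \<in> E}" for u v
    by auto
  moreover have "(\<Sum>u\<in>A. card {v \<in> B. (u, v) \<in> E}) = (\<Sum>v\<in>B. card {u \<in> A. (u, v) \<in> E})"
    using sum.swap_restrict[OF assms, of "\<lambda>_ _. 1 :: nat" "\<lambda>u v. (u, v) \<in> E"] by simp
  ultimately show ?thesis by simp
qed

text \<open>\<open>S\<close> and \<open>T\<close> are the sides of the completed copy without
  \<open>u\<close> and \<open>v\<close>, so a missing edge yields paths u - T - S - v with a
  complete middle part. The condition is symmetric in the two classes (\<open>swap\<close>), hence
  each lemma also holds for the converse of \<open>E\<close>.\<close>

locale sat_graph =
  fixes n s t :: nat and E :: "(nat \<times> nat) set"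
  assumes sub: "E \<subseteq> {..<n} \<times> {..<n}"
    and s_pos: "1 \<le> s"
    and s_less_t: "s < t"
    and sat: "u < n \<Longrightarrow> v < n \<Longrightarrow> (u, v) \<notin> E \<Longrightarrow>
      \<exists>S T. S \<subseteq> nbr (E\<inverse>) v \<and> T \<subseteq> nbr E u \<and> S \<times> T \<subseteq> E \<and>
        (card S = s - 1 \<and> card T = t - 1 \<or> card S = t - 1 \<and> card T = s - 1)"
begin

lemma swap: "sat_graph n s t (E\<inverse>)"
proof
  show "E\<inverse> \<subseteq> {..<n} \<times> {..<n}" using sub by auto
  show "1 \<le> s" "s < t" using s_pos s_less_t by auto
  fix u v assume "u < n" "v < n" "(u, v) \<notin> E\<inverse>"
  then obtain S T where ST: "S \<subseteq> nbr (E\<inverse>) u" "T \<subseteq> nbr E v" "S \<times> T \<subseteq> E"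
    "card S = s - 1 \<and> card T = t - 1 \<or> card S = t - 1 \<and> card T = s - 1"
    using sat[of v u] by auto
  have "T \<times> S \<subseteq> E\<inverse>" using ST(3) by auto
  then show "\<exists>S T. S \<subseteq> nbr ((E\<inverse>)\<inverse>) v \<and> T \<subseteq> nbr (E\<inverse>) u \<and> S \<times> T \<subseteq> E\<inverse> \<and>
      (card S = s - 1 \<and> card T = t - 1 \<or> card S = t - 1 \<and> card T = s - 1)"
    using ST by (metis converse_converse)
qed

lemma nbr_lessThan: "nbr E u \<subseteq> {..<n}" "nbr (E\<inverse>) v \<subseteq> {..<n}"
  using sub by auto

lemma finite_nbr [simp]: "finite (nbr E u)" "finite (nbr (E\<inverse>) v)"
  by (rule finite_subset[OF nbr_lessThan(1) finite_lessThan]) (rule finite_subset[OF nbr_lessThan(2) finite_lessThan])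

lemma card_E: "card E = (\<Sum>u<n. card (nbr E u))"
proof -
  have "E = (SIGMA u:{..<n}. nbr E u)" using sub by auto
  then have "card E = card (SIGMA u:{..<n}. nbr E u)" by (rule arg_cong)
  also have "\<dots> = (\<Sum>u<n. card (nbr E u))" by (subst card_SigmaI) auto
  finally show ?thesis .
qed

text \<open>The edge counts below all start here: degrees are used outside \<open>A\<close>, and the
  edges at \<open>A\<close> are counted from the other class.\<close>

lemma card_E_split:
  assumes "A \<subseteq> {..<n}"
  shows "card E = (\<Sum>u\<in>{..<n} - A. card (nbr E u)) + (\<Sum>v<n. card (nbr (E\<inverse>) v \<inter> A))"
proof -
  have "card E = (\<Sum>u\<in>{..<n} - A. card (nbr E u)) + (\<Sum>u\<in>A. card (nbr E u))"
    using card_E sum.subset_diff[OF assms] by simp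
  also have "(\<Sum>u\<in>A. card (nbr E u)) = (\<Sum>u\<in>A. card (nbr E u \<inter> {..<n}))"
    using nbr_lessThan by (simp add: Int_absorb2)
  also have "\<dots> = (\<Sum>v<n. card (nbr (E\<inverse>) v \<inter> A))"
    using assms by (intro double_count) (auto intro: finite_subset)
  finally show ?thesis .
qed

lemma degree_ge:
  assumes "u < n" "s - 1 \<le> n"
  shows "s - 1 \<le> card (nbr E u)"
proof (cases "\<forall>v<n. (u, v) \<in> E")
  case True
  then have "nbr E u = {..<n}" using nbr_lessThan by auto
  then show ?thesis using assms by simp
next
  case False
  then obtain v where "v < n" "(u, v) \<notin> E" by blast
  then obtain S T where "T \<subseteq> nbr E u" "card T \<ge> s - 1"
    using sat[of u v] assms(1) s_less_t by (metis diff_le_mono less_imp_le_nat order.refl)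
  then show ?thesis using card_mono[of "nbr E u" T] by simp
qed

text \<open>\<open>T\<close> lies in \<open>D\<close>, the neighbourhood of \<open>u\<close>, which
  is too small for \<open>t - 1\<close> vertices. So \<open>S\<close> has size \<open>t - 1\<close>
  and its members have \<open>s - 1\<close> neighbours in \<open>D\<close>, that is, they lie in
  \<open>A\<close>. Thus each \<open>v\<close> outside \<open>D\<close> has \<open>t - 1\<close>
  neighbours in \<open>A\<close>, each vertex of \<open>A\<close> sends \<open>s - 1\<close> edges
  to \<open>D\<close>, and the vertices outside \<open>A\<close> have degree at least
  \<open>s - 1\<close>. Only \<open>(t - 1) * card D\<close> is missing from the desired
  total.\<close>

lemma low_degree_bound:
  assumes u: "u < n" and deg: "card (nbr E u) \<le> t - 2" and t: "2 \<le> t" and n: "s - 1 \<le> n"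
  shows "(s + t - 2) * n \<le> card E + (t - 1) * (t - 2)"
proof -
  define D where "D = nbr E u"
  define A where "A = {x. x < n \<and> s - 1 \<le> card (nbr E x \<inter> D)}"
  have D: "D \<subseteq> {..<n}" "finite D" "card D \<le> t - 2" using nbr_lessThan deg by (auto simp: D_def)
  have A: "A \<subseteq> {..<n}" "finite A" by (auto simp: A_def)
  have VD: "t - 1 \<le> card (nbr (E\<inverse>) v \<inter> A)" if v: "v \<in> {..<n} - D" for v
  proof -
    obtain S T where ST: "S \<subseteq> nbr (E\<inverse>) v" "T \<subseteq> D" "S \<times> T \<subseteq> E"
        "card S = s - 1 \<and> card T = t - 1 \<or> card S = t - 1 \<and> card T = s - 1"
      using sat[of u v] u v unfolding D_def by auto
    have "card T \<le> t - 2" using card_mono[OF D(2) ST(2)] D(3) by simp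
    then have c: "card S = t - 1" "card T = s - 1" using ST(4) t by auto
    have "S \<subseteq> A"
    proof
      fix x assume x: "x \<in> S"
      then have "T \<subseteq> nbr E x \<inter> D" using ST by auto
      then have "s - 1 \<le> card (nbr E x \<inter> D)" using c card_mono[of "nbr E x \<inter> D" T] by simp
      then show "x \<in> A" using x ST(1) nbr_lessThan(2)[of v] by (auto simp: A_def)
    qed
    then have "S \<subseteq> nbr (E\<inverse>) v \<inter> A" using ST by auto
    then show ?thesis using c card_mono[of "nbr (E\<inverse>) v \<inter> A" S] by simp
  qed
  have "card E = (\<Sum>x\<in>{..<n} - A. card (nbr E x)) + (\<Sum>v<n. card (nbr (E\<inverse>) v \<inter> A))"
    using card_E_split[OF A(1)] .
  moreover have "(\<Sum>x\<in>{..<n} - A. card (nbr E x)) \<ge> (s - 1) * (n - card A)"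
  proof -
    have "(\<Sum>x\<in>{..<n} - A. s - 1) \<le> (\<Sum>x\<in>{..<n} - A. card (nbr E x))"
      using degree_ge n by (intro sum_mono) auto
    then show ?thesis using A by (simp add: card_Diff_subset mult.commute)
  qed
  moreover have "(\<Sum>v<n. card (nbr (E\<inverse>) v \<inter> A)) =
      (\<Sum>v\<in>{..<n} - D. card (nbr (E\<inverse>) v \<inter> A)) + (\<Sum>v\<in>D. card (nbr (E\<inverse>) v \<inter> A))"
    using sum.subset_diff[OF D(1)] by simp
  moreover have "(\<Sum>v\<in>{..<n} - D. card (nbr (E\<inverse>) v \<inter> A)) \<ge> (t - 1) * (n - card D)"
  proof -
    have "(\<Sum>v\<in>{..<n} - D. t - 1) \<le> (\<Sum>v\<in>{..<n} - D. card (nbr (E\<inverse>) v \<inter> A))"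
      using VD by (intro sum_mono) auto
    then show ?thesis using D by (simp add: card_Diff_subset mult.commute)
  qed
  moreover have "(\<Sum>v\<in>D. card (nbr (E\<inverse>) v \<inter> A)) \<ge> (s - 1) * card A"
  proof -
    have "(\<Sum>x\<in>A. s - 1) \<le> (\<Sum>x\<in>A. card (nbr E x \<inter> D))"
      by (intro sum_mono) (auto simp: A_def)
    then show ?thesis using double_count[OF A(2) D(2)] by (simp add: mult.commute)
  qed
  moreover have "card A \<le> n" "card D \<le> n" using A D card_mono[of "{..<n}"] by auto
  then have "(s - 1) * (n - card A) + (s - 1) * card A = (s - 1) * n"
      "(t - 1) * (n - card D) + (t - 1) * card D = (t - 1) * n"
    by (metis add_mult_distrib2 le_add_diff_inverse2)+
  moreover have "(t - 1) * card D \<le> (t - 1) * (t - 2)" using D by simp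
  moreover have "s + t - 2 = (s - 1) + (t - 1)"
    using s_pos s_less_t by simp
  then have "(s + t - 2) * n = (s - 1) * n + (t - 1) * n"
    by (simp only: add_mult_distrib)
  ultimately show ?thesis by linarith
qed

end

subsection \<open>The bound from a core\<close>

definition rich :: "nat \<Rightarrow> nat \<Rightarrow> (nat \<times> nat) set \<Rightarrow> nat set \<Rightarrow> nat set" where
  "rich n t E F = {v. v < n \<and> v \<notin> F \<and> t - 1 \<le> card (nbr (E\<inverse>) v \<inter> cnb n (E\<inverse>) F)}"

text \<open>\<open>F\<close> lies in the second colour class and \<open>y\<close> in the first. A rich vertex has \<open>t - 1\<close> neighbours that are
  joined to all of \<open>F\<close>, so each edge from it to a vertex that is not joined to all of \<open>F\<close> is in excess
  of the minimum degree; \<open>loss\<close> is what \<open>y\<close> lacks in edges to \<open>F\<close> after these gains.\<close>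

definition loss :: "nat \<Rightarrow> nat \<Rightarrow> (nat \<times> nat) set \<Rightarrow> nat set \<Rightarrow> nat \<Rightarrow> int" where
  "loss n t E F y = int (card (F - nbr E y)) - int (card (nbr E y \<inter> rich n t E F))"

lemma finite_rich [simp]: "finite (rich n t E F)"
  by (simp add: rich_def)

locale dense_sat_graph = sat_graph +
  assumes deg: "u < n \<Longrightarrow> t - 1 \<le> card (nbr E u)"
    and deg': "v < n \<Longrightarrow> t - 1 \<le> card (nbr (E\<inverse>) v)"
begin

lemma swap_dense: "dense_sat_graph n s t (E\<inverse>)"
  using swap deg deg' by (simp add: dense_sat_graph_def dense_sat_graph_axioms_def)

text \<open>A vertex outside \<open>F\<close> contributes \<open>t - 1\<close>, and if rich also its
  edges to \<open>Y\<close>; a vertex of the first class contributes \<open>s - 1\<close> edges to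
  \<open>F\<close> minus those it lacks. Regrouping the extra edges of rich vertices by their ends
  in \<open>Y\<close> turns the total deficit into the sum of the losses.\<close>

lemma loss_bound:
  assumes F: "F \<subseteq> {..<n}" "card F = s - 1"
  shows "int (s + t - 2) * int n - int (s - 1) * int (t - 1)
      - (\<Sum>y\<in>{..<n} - cnb n (E\<inverse>) F. loss n t E F y) \<le> int (card E)"
proof -
  define C where "C = cnb n (E\<inverse>) F"
  define Y where "Y = {..<n} - C"
  define R where "R = rich n t E F"
  have fin: "finite F" "finite Y" "finite R" "finite C" using F by (auto simp: Y_def R_def C_def intro: finite_subset)
  have C: "C \<subseteq> {..<n}" by (simp add: C_def cnb_lessThan)
  have R: "R \<subseteq> {..<n} - F" by (auto simp: R_def rich_def)
  have "card (E\<inverse>) = (\<Sum>v\<in>{..<n} - F. card (nbr (E\<inverse>) v)) + (\<Sum>u<n. card (nbr E u \<inter> F))"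
    using sat_graph.card_E_split[OF swap F(1)] by simp
  then have E: "card E = (\<Sum>v\<in>{..<n} - F. card (nbr (E\<inverse>) v)) + (\<Sum>u<n. card (nbr E u \<inter> F))"
    by simp
  have Fc: "card (nbr E u \<inter> F) + card (F - nbr E u) = s - 1" for u
  proof -
    have "card F = card ((nbr E u \<inter> F) \<union> (F - nbr E u))" by (rule arg_cong[of _ _ card]) auto
    also have "\<dots> = card (nbr E u \<inter> F) + card (F - nbr E u)"
      using fin by (intro card_Un_disjoint) auto
    finally show ?thesis using F by simp
  qed
  have "(\<Sum>u<n. card (nbr E u \<inter> F)) + (\<Sum>u<n. card (F - nbr E u)) = (s - 1) * n"
    by (simp add: sum.distrib[symmetric] Fc)
  moreover have "(\<Sum>u<n. card (F - nbr E u)) = (\<Sum>u\<in>Y. card (F - nbr E u))"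
  proof (rule sum.mono_neutral_right)
    show "\<forall>i\<in>{..<n} - Y. card (F - nbr E i) = 0"
    proof
      fix i assume "i \<in> {..<n} - Y"
      then have "i \<in> C" by (auto simp: Y_def)
      then have "F - nbr E i = {}" by (auto simp: C_def cnb_def)
      then show "card (F - nbr E i) = 0" by (simp only: card.empty)
    qed
  qed (auto simp: Y_def)
  ultimately have 1: "(\<Sum>u<n. card (nbr E u \<inter> F)) + (\<Sum>u\<in>Y. card (F - nbr E u)) = (s - 1) * n"
    by simp
  have dR: "t - 1 + card (nbr (E\<inverse>) v \<inter> Y) \<le> card (nbr (E\<inverse>) v)" if "v \<in> R" for v
  proof -
    have "t - 1 \<le> card (nbr (E\<inverse>) v \<inter> C)" using that by (simp add: R_def rich_def C_def)
    moreover have "card (nbr (E\<inverse>) v \<inter> C) + card (nbr (E\<inverse>) v \<inter> Y) = card ((nbr (E\<inverse>) v \<inter> C) \<union> (nbr (E\<inverse>) v \<inter> Y))"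
      using fin by (intro card_Un_disjoint[symmetric]) (auto simp: Y_def)
    moreover have "\<dots> \<le> card (nbr (E\<inverse>) v)" by (intro card_mono) auto
    ultimately show ?thesis by simp
  qed
  have "(\<Sum>v\<in>{..<n} - F. card (nbr (E\<inverse>) v)) \<ge> (\<Sum>v\<in>{..<n} - F. t - 1 + (if v \<in> R then card (nbr (E\<inverse>) v \<inter> Y) else 0))"
    using dR deg' by (intro sum_mono) auto
  moreover have "(\<Sum>v\<in>{..<n} - F. t - 1 + (if v \<in> R then card (nbr (E\<inverse>) v \<inter> Y) else 0))
      = (t - 1) * (n - (s - 1)) + (\<Sum>v\<in>R. card (nbr (E\<inverse>) v \<inter> Y))"
  proof -
    have "({..<n} - F) \<inter> R = R" using R by auto
    then show ?thesis
      using F fin by (simp add: sum.distrib sum.If_cases card_Diff_subset mult.commute)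
  qed
  moreover have "(\<Sum>v\<in>R. card (nbr (E\<inverse>) v \<inter> Y)) = (\<Sum>u\<in>Y. card (nbr E u \<inter> R))"
    using double_count[OF fin(2,3)] by simp
  ultimately have 2: "(\<Sum>v\<in>{..<n} - F. card (nbr (E\<inverse>) v)) \<ge> (t - 1) * (n - (s - 1)) + (\<Sum>u\<in>Y. card (nbr E u \<inter> R))"
    by simp
  have sn: "s - 1 \<le> n" using F card_mono[of "{..<n}" F] by simp
  have "int (card E) + (\<Sum>u\<in>Y. int (card (F - nbr E u))) - (\<Sum>u\<in>Y. int (card (nbr E u \<inter> R))) \<ge>
     int (t - 1) * (int n - int (s - 1)) + int (s - 1) * int n"
  proof -
    have "int (card E + (\<Sum>u\<in>Y. card (F - nbr E u))) \<ge> int ((t - 1) * (n - (s - 1)) + (\<Sum>u\<in>Y. card (nbr E u \<inter> R)) + (s - 1) * n)"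
      using E 1 2 by linarith
    moreover have "int (n - (s - 1)) = int n - int (s - 1)" using sn by simp
    ultimately show ?thesis by (simp only: of_nat_add of_nat_mult of_nat_sum)
  qed
  moreover have "int (s + t - 2) = int (s - 1) + int (t - 1)" using s_pos s_less_t by simp
  moreover have "(\<Sum>y\<in>Y. loss n t E F y) = (\<Sum>u\<in>Y. int (card (F - nbr E u))) - (\<Sum>u\<in>Y. int (card (nbr E u \<inter> R)))"
    by (simp add: loss_def R_def sum_subtractf)
  ultimately show ?thesis by (simp add: Y_def C_def algebra_simps)
qed

text \<open>The neighbours of \<open>y\<close> outside \<open>F\<close> are all rich. As
  \<open>y\<close> has at least \<open>t - 1\<close> neighbours and \<open>F\<close> has only
  \<open>s - 1\<close> members, these are at least as many as the members of \<open>F\<close> that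
  \<open>y\<close> misses, so no loss is positive.\<close>

lemma all_rich_bound:
  assumes F: "F \<subseteq> {..<n}" "card F = s - 1"
    and rich: "\<And>v. v < n \<Longrightarrow> v \<notin> F \<Longrightarrow> v \<in> rich n t E F"
  shows "int (s + t - 2) * int n - int (s - 1) * int (t - 1) \<le> int (card E)"
proof -
  have "loss n t E F y \<le> 0" if "y \<in> {..<n} - cnb n (E\<inverse>) F" for y
  proof -
    have fF: "finite F" using F finite_subset by blast
    have "nbr E y \<inter> rich n t E F = nbr E y - F"
      using rich nbr_lessThan(1)[of y] by (auto simp: rich_def)
    moreover have "card (nbr E y - F) + card (nbr E y \<inter> F) \<ge> t - 1"
      using deg[of y] that card_Un_le[of "nbr E y - F" "nbr E y \<inter> F"] by (simp add: Un_Diff_Int)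
    moreover have "card (F - nbr E y) + card (nbr E y \<inter> F) = s - 1"
    proof -
      have "card F = card ((nbr E y \<inter> F) \<union> (F - nbr E y))" by (rule arg_cong[of _ _ card]) auto
      also have "\<dots> = card (nbr E y \<inter> F) + card (F - nbr E y)"
        using fF by (intro card_Un_disjoint) auto
      finally show ?thesis using F by simp
    qed
    ultimately show ?thesis using s_less_t by (simp add: loss_def)
  qed
  then have "(\<Sum>y\<in>{..<n} - cnb n (E\<inverse>) F. loss n t E F y) \<le> 0" by (rule sum_nonpos)
  then show ?thesis using loss_bound[OF F] by linarith
qed

text \<open>The members of \<open>S\<close> cannot all be in \<open>G\<close> or rich, so one of them is joined to all of \<open>F\<close>;
  together with \<open>T\<close> this gives it so many neighbours that it is rich after all.\<close>

lemma no_wide_bridge: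
  assumes F: "F \<subseteq> {..<n}" "card F = s - 1" and G: "G \<subseteq> {..<n}" "card G = s - 1"
    and GF: "G \<times> F \<subseteq> E"
    and V: "\<And>v. v < n \<Longrightarrow> v \<notin> F \<Longrightarrow> v \<in> cnb n E G \<or> v \<in> rich n t E F"
    and U: "\<And>u. u < n \<Longrightarrow> u \<notin> G \<Longrightarrow> u \<in> cnb n (E\<inverse>) F \<or> u \<in> rich n t (E\<inverse>) G"
    and y: "loss n t E F y > 0" and z: "loss n t (E\<inverse>) G z > 0"
    and ST: "S \<subseteq> nbr (E\<inverse>) z" "T \<subseteq> nbr E y" "S \<times> T \<subseteq> E" "card S = s - 1" "card T = t - 1"
  shows False
proof -
  have fin: "finite F" "finite G" "finite S" "finite T"
    using F G ST by (auto intro: finite_subset[OF _ finite_nbr(1)] finite_subset[OF _ finite_nbr(2)] finite_subset)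
  \<comment> \<open>Positive loss at \<open>z\<close> says that \<open>z\<close> has fewer than
    \<open>s - 1\<close> neighbours that lie in \<open>G\<close> or are rich.\<close>
  have "\<not> S \<subseteq> (G \<inter> nbr (E\<inverse>) z) \<union> (nbr (E\<inverse>) z \<inter> rich n t (E\<inverse>) G)"
  proof
    assume "S \<subseteq> (G \<inter> nbr (E\<inverse>) z) \<union> (nbr (E\<inverse>) z \<inter> rich n t (E\<inverse>) G)"
    then have "card S \<le> card ((G \<inter> nbr (E\<inverse>) z) \<union> (nbr (E\<inverse>) z \<inter> rich n t (E\<inverse>) G))"
      by (intro card_mono) auto
    also have "\<dots> \<le> card (G \<inter> nbr (E\<inverse>) z) + card (nbr (E\<inverse>) z \<inter> rich n t (E\<inverse>) G)"
      by (rule card_Un_le)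
    finally have "card S \<le> card (G \<inter> nbr (E\<inverse>) z) + card (nbr (E\<inverse>) z \<inter> rich n t (E\<inverse>) G)" .
    moreover have "card G = card (G \<inter> nbr (E\<inverse>) z) + card (G - nbr (E\<inverse>) z)"
      using fin(2) by (metis card_Diff_subset_Int card_mono finite_Int inf_le1 le_add_diff_inverse)
    ultimately show False using z G ST by (simp add: loss_def)
  qed
  then obtain x where x: "x \<in> S" "x \<notin> G" "x \<notin> rich n t (E\<inverse>) G" using ST(1) by blast
  have "x < n" using x(1) ST(1) nbr_lessThan(2)[of z] by auto
  then have Fx: "F \<subseteq> nbr E x" using U[of x] x by (auto simp: cnb_def)
  \<comment> \<open>By positive loss at \<open>y\<close>, the part of \<open>F\<close> that
    \<open>y\<close> misses outnumbers the rich members removed from \<open>T\<close>, so this union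
    has at least \<open>t - 1\<close> members. All of them are joined to \<open>G\<close>: those in
    \<open>F\<close> by \<open>GF\<close>, the others by \<open>V\<close>.\<close>
  have "(F - nbr E y) \<union> (T - (nbr E y \<inter> rich n t E F)) \<subseteq> nbr E x \<inter> cnb n E G"
  proof
    fix v assume v: "v \<in> (F - nbr E y) \<union> (T - (nbr E y \<inter> rich n t E F))"
    then have "v \<in> nbr E x" using Fx ST(3) x(1) by auto
    moreover have "v < n" using calculation nbr_lessThan(1)[of x] by auto
    moreover have "v \<in> cnb n E G"
    proof (cases "v \<in> F")
      case True
      then show ?thesis using GF \<open>v < n\<close> by (auto simp: cnb_def)
    next
      case False
      then show ?thesis using V[of v] \<open>v < n\<close> v ST(2) by auto
    qed
    ultimately show "v \<in> nbr E x \<inter> cnb n E G" by simp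
  qed
  then have "card ((F - nbr E y) \<union> (T - (nbr E y \<inter> rich n t E F))) \<le> card (nbr E x \<inter> cnb n E G)"
    by (intro card_mono) auto
  moreover have "card ((F - nbr E y) \<union> (T - (nbr E y \<inter> rich n t E F))) =
      card (F - nbr E y) + card (T - (nbr E y \<inter> rich n t E F))"
    using fin ST(2) by (intro card_Un_disjoint) auto
  moreover have "card (T - (nbr E y \<inter> rich n t E F)) \<ge> card T - card (nbr E y \<inter> rich n t E F)"
    by (intro diff_card_le_card_Diff) auto
  ultimately have "t - 1 \<le> card (nbr E x \<inter> cnb n E G)"
    using y ST(5) by (simp add: loss_def)
  then show False using x \<open>x < n\<close> by (simp add: rich_def)
qed

end

definition losers :: "nat \<Rightarrow> nat \<Rightarrow> (nat \<times> nat) set \<Rightarrow> nat set \<Rightarrow> nat set" where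
  "losers n t E F = {y. y < n \<and> y \<notin> cnb n (E\<inverse>) F \<and> loss n t E F y > 0}"

lemma mult_diff_le_square_div_4:
  fixes x q :: int
  shows "x * (q - x) \<le> q\<^sup>2 div 4"
proof -
  have "4 * (x * (q - x)) = q\<^sup>2 - (q - 2 * x)\<^sup>2" by (simp add: power2_eq_square algebra_simps)
  then have "4 * (x * (q - x)) \<le> q\<^sup>2" by simp
  then have "(4 * (x * (q - x))) div 4 \<le> q\<^sup>2 div 4" by (rule zdiv_mono1) simp
  then show ?thesis by simp
qed

context dense_sat_graph
begin

definition core :: "nat set \<Rightarrow> nat set \<Rightarrow> bool" where
  "core F G \<longleftrightarrow> F \<subseteq> {..<n} \<and> card F = s - 1 \<and> G \<subseteq> {..<n} \<and> card G = s - 1 \<and> G \<times> F \<subseteq> E \<and>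
    (\<forall>v<n. v \<notin> F \<longrightarrow> v \<in> cnb n E G \<or> v \<in> rich n t E F) \<and>
    (\<forall>u<n. u \<notin> G \<longrightarrow> u \<in> cnb n (E\<inverse>) F \<or> u \<in> rich n t (E\<inverse>) G)"

lemma core_swap: "core F G \<Longrightarrow> dense_sat_graph.core n s t (E\<inverse>) G F"
  unfolding core_def dense_sat_graph.core_def[OF swap_dense] by auto

text \<open>The two shapes of a completed copy are exchanged by swapping the classes together with
  \<open>F\<close> and \<open>G\<close>, so \<open>no_wide_bridge\<close> excludes both.\<close>

lemma losers_adjacent:
  assumes c: "core F G" and y: "y \<in> losers n t E F" and z: "z \<in> losers n t (E\<inverse>) G"
  shows "(y, z) \<in> E"
proof (rule ccontr)
  assume "(y, z) \<notin> E"
  then obtain S T where ST: "S \<subseteq> nbr (E\<inverse>) z" "T \<subseteq> nbr E y" "S \<times> T \<subseteq> E"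
      "card S = s - 1 \<and> card T = t - 1 \<or> card S = t - 1 \<and> card T = s - 1"
    using sat[of y z] y z unfolding losers_def by blast
  from ST(4) show False
  proof
    assume "card S = s - 1 \<and> card T = t - 1"
    then show False
      using no_wide_bridge[of F G y z S T] c y z ST(1-3) unfolding core_def losers_def by blast
  next
    assume card: "card S = t - 1 \<and> card T = s - 1"
    have "T \<times> S \<subseteq> E\<inverse>" using ST(3) by auto
    then show False
      using dense_sat_graph.no_wide_bridge[OF swap_dense, of G F z y T S] core_swap[OF c] y z ST(1,2) card
      unfolding dense_sat_graph.core_def[OF swap_dense] losers_def converse_converse by blast
  qed
qed

text \<open>A loser \<open>z\<close> of the other class is not joined to \<open>G\<close>, hence
  rich, and it is adjacent to every loser \<open>y\<close>. So each such \<open>z\<close> lowers the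
  loss of \<open>y\<close> by one, starting from at most \<open>s - 1\<close>.\<close>

lemma core_bound_half:
  assumes c: "core F G"
  shows "int (s + t - 2) * int n - int (s - 1) * int (t - 1)
      - int (card (losers n t E F)) * (int (s - 1) - int (card (losers n t (E\<inverse>) G))) \<le> int (card E)"
proof -
  let ?Y = "{..<n} - cnb n (E\<inverse>) F"
  let ?q = "int (s - 1) - int (card (losers n t (E\<inverse>) G))"
  have F: "F \<subseteq> {..<n}" "card F = s - 1" using c by (auto simp: core_def)
  have "(\<Sum>y\<in>?Y. loss n t E F y) \<le> (\<Sum>y\<in>?Y. if y \<in> losers n t E F then loss n t E F y else 0)"
    by (intro sum_mono) (auto simp: losers_def)
  also have "\<dots> = (\<Sum>y\<in>losers n t E F. loss n t E F y)"
    by (simp add: sum.inter_restrict[symmetric]) (rule sum.cong, auto simp: losers_def)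
  also have "\<dots> \<le> (\<Sum>y\<in>losers n t E F. ?q)"
  proof (rule sum_mono)
    fix y assume y: "y \<in> losers n t E F"
    have "losers n t (E\<inverse>) G \<subseteq> nbr E y \<inter> rich n t E F"
    proof
      fix z assume z: "z \<in> losers n t (E\<inverse>) G"
      then have "z < n" "z \<notin> cnb n E G" by (auto simp: losers_def)
      moreover have "z \<notin> F" using calculation c by (auto simp: core_def cnb_def)
      ultimately have "z \<in> rich n t E F" using c unfolding core_def by blast
      then show "z \<in> nbr E y \<inter> rich n t E F" using losers_adjacent[OF c y z] by simp
    qed
    then have "card (losers n t (E\<inverse>) G) \<le> card (nbr E y \<inter> rich n t E F)" by (intro card_mono) auto
    moreover have "card (F - nbr E y) \<le> card F"
      using F finite_subset[of F "{..<n}"] by (intro card_mono) auto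
    ultimately show "loss n t E F y \<le> ?q" using F by (simp add: loss_def)
  qed
  also have "\<dots> = int (card (losers n t E F)) * ?q" by simp
  finally show ?thesis using loss_bound[OF F] by linarith
qed

text \<open>Of the two half bounds, the one for the class with fewer losers is used: if x \<le> z,
  then x * (q - z) \<le> x * (q - x) \<le> q^2 / 4.\<close>

lemma core_bound:
  assumes c: "core F G"
  shows "int (s + t - 2) * int n - int (s - 1) * int (t - 1) - (int (s - 1))\<^sup>2 div 4 \<le> int (card E)"
proof -
  let ?x = "int (card (losers n t E F))" and ?z = "int (card (losers n t (E\<inverse>) G))" and ?q = "int (s - 1)"
  have "?x * (?q - ?z) \<le> ?q\<^sup>2 div 4 \<or> ?z * (?q - ?x) \<le> ?q\<^sup>2 div 4"
  proof (cases "?x \<le> ?z")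
    case True
    then have "?x * (?q - ?z) \<le> ?x * (?q - ?x)" by (intro mult_left_mono) auto
    then show ?thesis using mult_diff_le_square_div_4[of ?x ?q] by linarith
  next
    case False
    then have "?z * (?q - ?x) \<le> ?z * (?q - ?z)" by (intro mult_left_mono) auto
    then show ?thesis using mult_diff_le_square_div_4[of ?z ?q] by linarith
  qed
  then show ?thesis
    using core_bound_half[OF c] dense_sat_graph.core_bound_half[OF swap_dense core_swap[OF c]]
    unfolding card_inverse converse_converse by linarith
qed

end

subsection \<open>Typical vertices\<close>

text \<open>The exceptional vertices outside \<open>H\<close> are measured by their total degree, not by their number: then
  only few typical vertices have an exceptional neighbour, and passing to \<open>inner\<close> merely multiplies
  \<open>\<mu>\<close> by \<open>t\<close> (\<open>base_inner\<close>).\<close>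

definition base :: "nat \<Rightarrow> nat \<Rightarrow> nat \<Rightarrow> (nat \<times> nat) set \<Rightarrow> nat set \<Rightarrow> nat set \<Rightarrow> nat set \<Rightarrow> nat \<Rightarrow> bool" where
  "base n s t E H K U \<mu> \<longleftrightarrow> U \<subseteq> {..<n} - H \<and>
    (\<forall>u\<in>U. card (nbr E u) = t - 1 \<and> card (nbr E u \<inter> K) = s - 1) \<and>
    (\<Sum>u\<in>{..<n} - H - U. card (nbr E u)) \<le> \<mu>"

definition inner :: "(nat \<times> nat) set \<Rightarrow> nat set \<Rightarrow> nat set \<Rightarrow> nat set \<Rightarrow> nat set" where
  "inner E K U V = {u \<in> U. nbr E u - K \<subseteq> V}"

text \<open>The ends of walks u - w - x - v with \<open>w\<close> in \<open>A\<close> and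
  \<open>x\<close> in \<open>B\<close>. This matches the paths u - T - S - v of a completed copy,
  with \<open>A\<close> and \<open>B\<close> usually consisting of low vertices.\<close>

definition reach :: "(nat \<times> nat) set \<Rightarrow> nat set \<Rightarrow> nat set \<Rightarrow> nat \<Rightarrow> nat set" where
  "reach E A B u = (\<Union>w\<in>nbr E u \<inter> A. \<Union>x\<in>nbr (E\<inverse>) w \<inter> B. nbr E x)"

lemma reachI:
  "(u, w) \<in> E \<Longrightarrow> w \<in> A \<Longrightarrow> (x, w) \<in> E \<Longrightarrow> x \<in> B \<Longrightarrow> (x, v) \<in> E \<Longrightarrow> v \<in> reach E A B u"
  unfolding reach_def by (rule UN_I[of w], simp, rule UN_I[of x]) simp_all

lemma card_UN_le_mult:
  assumes "finite I" "card I \<le> a" "\<And>i. i \<in> I \<Longrightarrow> card (A i) \<le> b"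
  shows "card (\<Union>i\<in>I. A i) \<le> a * b"
proof -
  have "card (\<Union>i\<in>I. A i) \<le> (\<Sum>i\<in>I. card (A i))" by (rule card_UN_le[OF assms(1)])
  also have "\<dots> \<le> (\<Sum>i\<in>I. b)" by (rule sum_mono) (rule assms(3))
  also have "\<dots> \<le> a * b" using assms(2) by simp
  finally show ?thesis .
qed

context sat_graph
begin

lemma finite_reach [simp]: "finite (reach E A B u)" "finite (reach (E\<inverse>) A B u)"
  by (auto simp: reach_def)

lemma card_reach:
  assumes "card (nbr E u \<inter> A) \<le> a" "\<And>w. w \<in> A \<Longrightarrow> card (nbr (E\<inverse>) w) \<le> b" "\<And>x. x \<in> B \<Longrightarrow> card (nbr E x) \<le> c"
  shows "card (reach E A B u) \<le> a * (b * c)"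
  unfolding reach_def
proof (rule card_UN_le_mult)
  fix w assume w: "w \<in> nbr E u \<inter> A"
  show "card (\<Union>x\<in>nbr (E\<inverse>) w \<inter> B. nbr E x) \<le> b * c"
  proof (rule card_UN_le_mult)
    show "card (nbr (E\<inverse>) w \<inter> B) \<le> b"
      using assms(2)[of w] w card_mono[of "nbr (E\<inverse>) w" "nbr (E\<inverse>) w \<inter> B"] by simp
  qed (use assms(3) in auto)
qed (use assms(1) in auto)

lemma card_meeting:
  assumes "finite W"
  shows "card {u \<in> X. nbr E u \<inter> W \<noteq> {}} \<le> (\<Sum>w\<in>W. card (nbr (E\<inverse>) w))"
proof -
  have "{u \<in> X. nbr E u \<inter> W \<noteq> {}} \<subseteq> (\<Union>w\<in>W. nbr (E\<inverse>) w)" by auto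
  then have "card {u \<in> X. nbr E u \<inter> W \<noteq> {}} \<le> card (\<Union>w\<in>W. nbr (E\<inverse>) w)"
    using assms by (intro card_mono) auto
  also have "\<dots> \<le> (\<Sum>w\<in>W. card (nbr (E\<inverse>) w))" by (rule card_UN_le[OF assms])
  finally show ?thesis .
qed

end

context dense_sat_graph
begin

abbreviation base_U where "base_U \<equiv> base n s t E"
abbreviation base_V where "base_V \<equiv> base n s t (E\<inverse>)"

lemma baseD:
  assumes "base_U H K U \<mu>" "u \<in> U"
  shows "u < n" "u \<notin> H" "card (nbr E u) = t - 1" "card (nbr E u \<inter> K) = s - 1"
  using assms unfolding base_def by blast+

lemma base_finite: "base_U H K U \<mu> \<Longrightarrow> finite U"
  by (auto simp: base_def intro: finite_subset)

lemma base_mono: "base_U H K U \<mu> \<Longrightarrow> \<mu> \<le> \<nu> \<Longrightarrow> base_U H K U \<nu>"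
  by (auto simp: base_def)

lemma base_shrink:
  assumes "base_U H K U \<mu>" "U' \<subseteq> U" "card (U - U') \<le> \<kappa>"
  shows "base_U H K U' (\<mu> + (t - 1) * \<kappa>)"
proof -
  have fin: "finite U" by (rule base_finite[OF assms(1)])
  have "{..<n} - H - U' = ({..<n} - H - U) \<union> (U - U')"
    using assms by (auto simp: base_def)
  then have "(\<Sum>u\<in>{..<n} - H - U'. card (nbr E u)) =
      (\<Sum>u\<in>{..<n} - H - U. card (nbr E u)) + (\<Sum>u\<in>U - U'. card (nbr E u))"
    using fin by (simp add: sum.union_disjoint Diff_Int_distrib2 Diff_triv inf_commute)
  also have "(\<Sum>u\<in>U - U'. card (nbr E u)) = (\<Sum>u\<in>U - U'. t - 1)"
    using assms(1) by (intro sum.cong) (auto simp: base_def)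
  also have "\<dots> \<le> (t - 1) * \<kappa>" using assms(3) by simp
  finally show ?thesis using assms(1,2) by (auto simp: base_def)
qed

text \<open>A vertex dropped from \<open>U\<close> has a neighbour in the exceptional part of the
  other class, whose total degree is at most \<open>\<mu>\<close>. So at most \<open>\<mu>\<close>
  vertices are dropped, each of degree \<open>t - 1\<close>.\<close>

lemma base_inner:
  assumes U: "base_U H K U \<mu>" and V: "base_V K H V \<mu>"
  shows "base_U H K (inner E K U V) (t * \<mu>)"
proof -
  have "U - inner E K U V \<subseteq> {u \<in> U. nbr E u \<inter> ({..<n} - K - V) \<noteq> {}}"
    using nbr_lessThan(1) by (auto simp: inner_def)
  then have "card (U - inner E K U V) \<le> card {u \<in> U. nbr E u \<inter> ({..<n} - K - V) \<noteq> {}}"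
    using base_finite[OF U] by (intro card_mono) auto
  also have "\<dots> \<le> (\<Sum>w\<in>{..<n} - K - V. card (nbr (E\<inverse>) w))" by (rule card_meeting) simp
  also have "\<dots> \<le> \<mu>" using V by (simp add: base_def)
  finally have "base_U H K (inner E K U V) (\<mu> + (t - 1) * \<mu>)"
    using U by (intro base_shrink) (auto simp: inner_def)
  moreover have "\<mu> + (t - 1) * \<mu> = t * \<mu>" using s_less_t by (cases t) auto
  ultimately show ?thesis by simp
qed

text \<open>All degrees are positive because \<open>t - 1 \<ge> 1\<close>, so the total degree of
  the exceptional vertices also bounds their number.\<close>

lemma base_size:
  assumes U: "base_U H K U \<mu>" and H: "finite H"
  shows "n \<le> card U + card H + \<mu>"
proof -
  have "card ({..<n} - H - U) = (\<Sum>u\<in>{..<n} - H - U. 1)" by simp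
  also have "\<dots> \<le> (\<Sum>u\<in>{..<n} - H - U. card (nbr E u))"
    using deg s_pos s_less_t by (intro sum_mono) (force intro: order_trans[rotated])
  also have "\<dots> \<le> \<mu>" using U by (simp add: base_def)
  finally have "card ({..<n} - H - U) \<le> \<mu>" .
  moreover have "{..<n} \<subseteq> ({..<n} - H - U) \<union> U \<union> H" by auto
  then have "card {..<n} \<le> card (({..<n} - H - U) \<union> U \<union> H)"
    using H base_finite[OF U] by (intro card_mono) auto
  then have "n \<le> card ({..<n} - H - U) + card U + card H"
    using card_Un_le[of "({..<n} - H - U) \<union> U" H] card_Un_le[of "{..<n} - H - U" U] by simp
  ultimately show ?thesis by simp
qed

lemma base_low_nbr:
  assumes "base_U H K U \<mu>" "u \<in> U"
  obtains w where "w \<in> nbr E u - K"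
proof -
  have "card (nbr E u \<inter> K) < card (nbr E u)"
    using assms s_pos s_less_t by (auto simp: base_def)
  then have "nbr E u \<inter> K \<noteq> nbr E u" by auto
  then show ?thesis using that by blast
qed

lemma base_high_eq:
  assumes U: "base_U H K U \<mu>" "u \<in> U" and T: "T \<subseteq> nbr E u" "T \<subseteq> K" "s - 1 \<le> card T"
  shows "T = nbr E u \<inter> K" "card T = s - 1"
proof -
  have c: "card (nbr E u \<inter> K) = s - 1" using U by (auto simp: base_def)
  show "T = nbr E u \<inter> K" using T c by (intro card_seteq) auto
  then show "card T = s - 1" using c by simp
qed

lemma base_nbr_eq:
  assumes U: "base_U H K U \<mu>" "u \<in> U" and T: "T \<subseteq> nbr E u" "card T = t - 1"
  shows "T = nbr E u"
  using U T by (intro card_seteq) (auto simp: base_def)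

end

section \<open>Missing edges between typical vertices\<close>

context dense_sat_graph
begin

lemmas baseD' = dense_sat_graph.baseD[OF swap_dense, unfolded converse_converse]
lemmas base_high_eq' = dense_sat_graph.base_high_eq[OF swap_dense, unfolded converse_converse]
lemmas base_nbr_eq' = dense_sat_graph.base_nbr_eq[OF swap_dense, unfolded converse_converse]
lemmas base_low_nbr' = dense_sat_graph.base_low_nbr[OF swap_dense, unfolded converse_converse]
lemmas base_inner' = dense_sat_graph.base_inner[OF swap_dense, unfolded converse_converse]
lemmas base_mono' = dense_sat_graph.base_mono[OF swap_dense, unfolded converse_converse]
lemmas card_reach' = sat_graph.card_reach[OF swap, unfolded converse_converse]

text \<open>The completed copy contains a path \<open>u - T - S - v\<close>. If \<open>v\<close> cannot be reached through low vertices,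
  then \<open>T \<subseteq> K\<close> or \<open>S \<subseteq> H\<close>, which forces \<open>T\<close> or \<open>S\<close> to be the whole set of high neighbours of \<open>u\<close> or \<open>v\<close>.\<close>

lemma far_pair:
  assumes U: "base_U H K U \<mu>" and V: "base_V K H V \<mu>"
    and u: "u \<in> inner E K U V" and v: "v \<in> inner (E\<inverse>) H V U"
    and far: "(u, v) \<notin> E" "v \<notin> reach E V U u"
  shows "(\<forall>w\<in>nbr E u - K. nbr (E\<inverse>) w \<inter> H = nbr (E\<inverse>) v \<inter> H) \<or>
    (\<forall>x\<in>nbr (E\<inverse>) v - H. nbr E x \<inter> K = nbr E u \<inter> K)"
proof -
  have uU: "u \<in> U" "nbr E u - K \<subseteq> V" and vV: "v \<in> V" "nbr (E\<inverse>) v - H \<subseteq> U"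
    using u v by (auto simp: inner_def)
  have "u < n" "v < n" using baseD(1)[OF U uU(1)] baseD'(1)[OF V vV(1)] .
  then obtain S T where ST: "S \<subseteq> nbr (E\<inverse>) v" "T \<subseteq> nbr E u" "S \<times> T \<subseteq> E"
      "card S = s - 1 \<and> card T = t - 1 \<or> card S = t - 1 \<and> card T = s - 1"
    using sat[OF _ _ far(1)] by blast
  have ge: "s - 1 \<le> card S" "s - 1 \<le> card T" "s - 1 < t - 1" using ST(4) s_pos s_less_t by auto
  show ?thesis
  proof (cases "T \<subseteq> K")
    case True
    have T: "T = nbr E u \<inter> K" "card T = s - 1"
      using base_high_eq[OF U uU(1) ST(2) True ge(2)] .
    \<comment> \<open>Having size \<open>t - 1\<close>, \<open>S\<close> is the whole neighbourhood
      of \<open>v\<close>; so \<open>T\<close>, the set of high neighbours of \<open>u\<close>, is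
      joined to every low neighbour of \<open>v\<close>.\<close>
    then have S: "S = nbr (E\<inverse>) v"
      using base_nbr_eq'[OF V vV(1) ST(1)] ST(4) ge(3) by auto
    have "nbr E x \<inter> K = nbr E u \<inter> K" if x: "x \<in> nbr (E\<inverse>) v - H" for x
    proof -
      have "x \<in> U" using x vV(2) by blast
      moreover have "x \<in> S" using x S by blast
      then have "T \<subseteq> nbr E x" using ST(3) by auto
      ultimately show ?thesis using base_high_eq(1)[OF U _ _ True ge(2), of x] T(1) by simp
    qed
    then show ?thesis by blast
  next
    case False
    then obtain w0 where w0: "w0 \<in> T" "w0 \<notin> K" by blast
    have SH: "S \<subseteq> H"
    proof
      fix x assume x: "x \<in> S"
      show "x \<in> H"
      proof (rule ccontr)
        assume "x \<notin> H"
        then have "x \<in> U" using x ST(1) vV(2) by auto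
        moreover have "w0 \<in> V" using w0 ST(2) uU(2) by auto
        ultimately have "w0 \<in> nbr E u \<inter> V" "x \<in> nbr (E\<inverse>) w0 \<inter> U" "v \<in> nbr E x"
          using subsetD[OF ST(1) x] subsetD[OF ST(2) w0(1)] subsetD[OF ST(3), of "(x, w0)"] x w0(1) by simp_all
        then have "v \<in> reach E V U u" unfolding reach_def by blast
        then show False using far(2) by simp
      qed
    qed
    have S: "S = nbr (E\<inverse>) v \<inter> H" "card S = s - 1"
      using base_high_eq'[OF V vV(1) ST(1) SH ge(1)] .
    then have T: "T = nbr E u"
      using base_nbr_eq[OF U uU(1) ST(2)] ST(4) ge(3) by auto
    have "nbr (E\<inverse>) w \<inter> H = nbr (E\<inverse>) v \<inter> H" if w: "w \<in> nbr E u - K" for w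
    proof -
      have "w \<in> V" using w uU(2) by blast
      moreover have "w \<in> T" using w T by blast
      then have "S \<subseteq> nbr (E\<inverse>) w" using ST(3) by auto
      ultimately show ?thesis using base_high_eq'(1)[OF V _ _ SH ge(1), of w] S(1) by simp
    qed
    then show ?thesis by blast
  qed
qed

lemma card_near:
  assumes U: "base_U H K U \<mu>" and V: "base_V K H V \<mu>" and u: "u \<in> U"
  shows "card (nbr E u \<union> reach E V U u) \<le> t ^ 3"
proof -
  have "card (nbr E u \<inter> V) \<le> card (nbr E u)" by (intro card_mono) auto
  then have "card (reach E V U u) \<le> (t - 1) * ((t - 1) * (t - 1))"
    using baseD(3)[OF U] baseD'(3)[OF V] u by (intro card_reach) simp_all
  moreover have "card (nbr E u) = t - 1" using baseD(3)[OF U u] .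
  ultimately have "card (nbr E u \<union> reach E V U u) \<le> (t - 1) + (t - 1) * ((t - 1) * (t - 1))"
    using card_Un_le[of "nbr E u" "reach E V U u"] by linarith
  also have "\<dots> \<le> t ^ 3" by (cases t) (auto simp: power3_eq_cube algebra_simps)
  finally show ?thesis .
qed

text \<open>Take a typical \<open>u0\<close>. Either every far \<open>v\<close> satisfies the first alternative of \<open>far_pair\<close>, which fixes
  the high neighbours of \<open>v\<close>; or some far \<open>v1\<close> does not. In the latter case a low neighbour \<open>x1\<close> of \<open>v1\<close> has
  the same high neighbours as \<open>u0\<close>, and no \<open>v\<close> far from both can satisfy the first alternative with
  \<open>u0\<close> and with \<open>x1\<close>.\<close>

lemma high_nbrs_const:
  assumes U: "base_U H K U \<mu>" and V: "base_V K H V \<mu>"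
    and U2: "U2 = inner E K U V" and V2: "V2 = inner (E\<inverse>) H V U"
    and U3: "U3 = inner E K U2 V2" and V3: "V3 = inner (E\<inverse>) H V2 U2"
    and u0: "u0 \<in> U2"
  shows "(\<exists>F. card {u \<in> U3. nbr E u \<inter> K \<noteq> F} \<le> 2 * t ^ 4) \<or>
    (\<exists>G. card {v \<in> V3. nbr (E\<inverse>) v \<inter> H \<noteq> G} \<le> 2 * t ^ 4)"
proof -
  define near where "near = (\<lambda>u. nbr E u \<union> reach E V U u)"
  have near: "card (near u) \<le> t ^ 3" "finite (near u)" if "u \<in> U" for u
    using card_near[OF U V that] by (auto simp: near_def)
  \<comment> \<open>This concerns pairs from \<open>U2\<close> and \<open>V2\<close>. The low
    neighbours of vertices in \<open>U3\<close> and \<open>V3\<close> lie in \<open>V2\<close> and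
    \<open>U2\<close>, so it can be applied to them as well.\<close>
  have far: "(\<forall>w\<in>nbr E u - K. nbr (E\<inverse>) w \<inter> H = nbr (E\<inverse>) v \<inter> H) \<or>
      (\<forall>x\<in>nbr (E\<inverse>) v - H. nbr E x \<inter> K = nbr E u \<inter> K)"
    if "u \<in> U2" "v \<in> V2" "v \<notin> near u" for u v
    using far_pair[OF U V, of u v] that by (simp add: U2 V2 near_def)
  have sub: "U2 \<subseteq> U" "V2 \<subseteq> V" "V3 \<subseteq> V2" by (auto simp: U2 V2 V3 inner_def)
  have t: "t ^ 3 \<le> 2 * t ^ 4" using s_less_t by (simp add: power3_eq_cube power4_eq_xxxx)
  show ?thesis
  proof (cases "\<forall>v\<in>V3 - near u0. \<forall>w\<in>nbr E u0 - K. nbr (E\<inverse>) w \<inter> H = nbr (E\<inverse>) v \<inter> H")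
    case True
    obtain w where w: "w \<in> nbr E u0 - K" using base_low_nbr[OF U] u0 sub by blast
    have "{v \<in> V3. nbr (E\<inverse>) v \<inter> H \<noteq> nbr (E\<inverse>) w \<inter> H} \<subseteq> near u0" using True w by blast
    then have "card {v \<in> V3. nbr (E\<inverse>) v \<inter> H \<noteq> nbr (E\<inverse>) w \<inter> H} \<le> t ^ 3"
      using near[of u0] u0 sub(1) card_mono[of "near u0"] by (meson order.trans subsetD)
    then show ?thesis using t order.trans by blast
  next
    case False
    then obtain v1 w1 where v1: "v1 \<in> V3" "v1 \<notin> near u0" and w1: "w1 \<in> nbr E u0 - K"
        "nbr (E\<inverse>) w1 \<inter> H \<noteq> nbr (E\<inverse>) v1 \<inter> H" by blast
    define F where "F = nbr E u0 \<inter> K"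
    have F1: "nbr E x \<inter> K = F" if "x \<in> nbr (E\<inverse>) v1 - H" for x
      using far[OF u0, of v1] v1 w1 sub that unfolding F_def by blast
    have v1V: "v1 \<in> V" "v1 \<notin> K" using v1(1) sub baseD'(2)[OF V, of v1] by blast+
    obtain x1 where x1: "x1 \<in> nbr (E\<inverse>) v1 - H" using base_low_nbr'[OF V v1V(1)] .
    have x1U: "x1 \<in> U2" using x1 v1(1) by (auto simp: V3 inner_def)
    have v1x1: "v1 \<in> nbr E x1 - K" using x1 v1V by simp
    have FV: "nbr E x \<inter> K = F" if v: "v \<in> V2" "v \<notin> near u0" "v \<notin> near x1" and x: "x \<in> nbr (E\<inverse>) v - H" for v x
    proof (rule ccontr)
      assume ne: "nbr E x \<inter> K \<noteq> F"
      then have "nbr (E\<inverse>) w1 \<inter> H = nbr (E\<inverse>) v \<inter> H"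
        using far[OF u0 v(1,2)] w1(1) x unfolding F_def by blast
      moreover have "nbr (E\<inverse>) v1 \<inter> H = nbr (E\<inverse>) v \<inter> H"
        using far[OF x1U v(1,3)] v1x1 x ne F1[OF x1] by blast
      ultimately show False using w1(2) by simp
    qed
    define W where "W = (near u0 \<union> near x1) \<inter> V"
    have fW: "finite W" using near(2) u0 x1U sub by (auto simp: W_def)
    \<comment> \<open>By \<open>FV\<close>, a vertex of \<open>U3\<close> whose high neighbourhood
      is not \<open>F\<close> has its low neighbours near \<open>u0\<close> or \<open>x1\<close>.
      Only boundedly many vertices are near, and those in \<open>V\<close> have degree
      \<open>t - 1\<close>.\<close>
    have "{u \<in> U3. nbr E u \<inter> K \<noteq> F} \<subseteq> {u \<in> U3. nbr E u \<inter> W \<noteq> {}}"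
    proof
      fix u assume u: "u \<in> {u \<in> U3. nbr E u \<inter> K \<noteq> F}"
      then have uU: "u \<in> U" "u \<notin> H" using sub(1) baseD(2)[OF U, of u] by (auto simp: U3 inner_def)
      obtain w where w: "w \<in> nbr E u - K" using base_low_nbr[OF U uU(1)] .
      then have "w \<in> V2" using u by (auto simp: U3 inner_def)
      moreover have "u \<in> nbr (E\<inverse>) w - H" using w uU by simp
      ultimately have "w \<in> W" using FV[of w u] u sub(2) by (auto simp: W_def)
      then show "u \<in> {u \<in> U3. nbr E u \<inter> W \<noteq> {}}" using w u by blast
    qed
    moreover have fU3: "finite U3" using finite_subset[OF sub(1) base_finite[OF U]] by (simp add: U3 inner_def)
    ultimately have "card {u \<in> U3. nbr E u \<inter> K \<noteq> F} \<le> card {u \<in> U3. nbr E u \<inter> W \<noteq> {}}"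
      by (intro card_mono) auto
    also have "\<dots> \<le> (\<Sum>w\<in>W. card (nbr (E\<inverse>) w))" by (rule card_meeting[OF fW])
    also have "\<dots> = (\<Sum>w\<in>W. t - 1)" using baseD'(3)[OF V] by (intro sum.cong) (auto simp: W_def)
    also have "\<dots> = card W * (t - 1)" by simp
    also have "\<dots> \<le> (2 * t ^ 3) * t"
    proof (rule mult_le_mono)
      have "card W \<le> card (near u0 \<union> near x1)"
        using near(2) u0 x1U sub by (intro card_mono) (auto simp: W_def)
      then show "card W \<le> 2 * t ^ 3"
        using card_Un_le[of "near u0" "near x1"] near(1)[of u0] near(1)[of x1] u0 x1U sub by force
    qed simp
    also have "\<dots> = 2 * t ^ 4" by (simp add: power3_eq_cube power4_eq_xxxx)
    finally show ?thesis by blast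
  qed
qed

end

section \<open>A core from a constant high neighbourhood\<close>

lemma card_vimage_pigeonhole:
  assumes "finite A" "finite B" "f ` A \<subseteq> B" "card B * k < card A"
  shows "\<exists>b\<in>B. k < card {a \<in> A. f a = b}"
proof (rule ccontr)
  assume "\<not> ?thesis"
  then have le: "card {a \<in> A. f a = b} \<le> k" if "b \<in> B" for b using that by auto
  have "A = (\<Union>b\<in>B. {a \<in> A. f a = b})" using assms(3) by auto
  then have "card A = card (\<Union>b\<in>B. {a \<in> A. f a = b})" by (rule arg_cong)
  also have "\<dots> \<le> card B * k" using assms(2) le by (intro card_UN_le_mult) auto
  finally show False using assms(4) by simp
qed

context dense_sat_graph
begin

text \<open>\<open>v\<close> may be a high vertex, so its degree is not bounded. But all of
  \<open>U\<close> is joined to \<open>F\<close>, and a vertex that is not rich has at most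
  \<open>t - 2\<close> neighbours joined to \<open>F\<close>; this keeps the walks through
  \<open>U\<close> few.\<close>

lemma poor_vertex_near:
  assumes U: "base_U H K U \<mu>" and V: "base_V K H V \<mu>"
    and F: "\<And>u. u \<in> U \<Longrightarrow> nbr E u \<inter> K = F"
    and v: "v < n" "v \<notin> F" "v \<notin> rich n t E F"
  shows "card ((nbr (E\<inverse>) v \<inter> U) \<union> reach (E\<inverse>) U V v) \<le> t ^ 3"
    "card (nbr (E\<inverse>) v \<inter> cnb n (E\<inverse>) F) \<le> t - 2"
proof -
  show c: "card (nbr (E\<inverse>) v \<inter> cnb n (E\<inverse>) F) \<le> t - 2"
    using v by (auto simp: rich_def)
  have "U \<subseteq> cnb n (E\<inverse>) F"
    using F baseD(1)[OF U] by (fastforce simp: cnb_def)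
  then have "card (nbr (E\<inverse>) v \<inter> U) \<le> card (nbr (E\<inverse>) v \<inter> cnb n (E\<inverse>) F)"
    by (intro card_mono) auto
  then have cU: "card (nbr (E\<inverse>) v \<inter> U) \<le> t - 2" using c by simp
  then have "card (reach (E\<inverse>) U V v) \<le> (t - 2) * ((t - 1) * (t - 1))"
    using baseD(3)[OF U] baseD'(3)[OF V] by (intro card_reach') simp_all
  then have "card ((nbr (E\<inverse>) v \<inter> U) \<union> reach (E\<inverse>) U V v) \<le> (t - 2) + (t - 2) * ((t - 1) * (t - 1))"
    using cU card_Un_le[of "nbr (E\<inverse>) v \<inter> U" "reach (E\<inverse>) U V v"] by linarith
  also have "\<dots> \<le> t ^ 3"
  proof -
    obtain m where "t = m + 2" using s_pos s_less_t by (metis One_nat_def Suc_1 Suc_leI add.commute le_Suc_ex le_less_trans)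
    then show ?thesis by (simp add: power3_eq_cube algebra_simps)
  qed
  finally show "card ((nbr (E\<inverse>) v \<inter> U) \<union> reach (E\<inverse>) U V v) \<le> t ^ 3" .
qed

text \<open>As in \<open>far_pair\<close>, but here \<open>T \<subseteq> K\<close> is impossible: it
  would make \<open>T = F\<close>, and then the \<open>t - 1\<close> members of \<open>S\<close>
  would make \<open>v\<close> rich. So \<open>S\<close> is high and \<open>T\<close> is the whole
  neighbourhood of \<open>u\<close>, which contains \<open>F\<close>.\<close>

lemma poor_vertex_joined:
  assumes U: "base_U H K U \<mu>" and V: "base_V K H V \<mu>"
    and F: "\<And>u. u \<in> U \<Longrightarrow> nbr E u \<inter> K = F"
    and v: "v < n" "v \<notin> F" "v \<notin> rich n t E F"
    and u: "u \<in> inner E K U (inner (E\<inverse>) H V U)"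
      "u \<notin> (nbr (E\<inverse>) v \<inter> U) \<union> reach (E\<inverse>) U V v"
  obtains S where "S \<subseteq> nbr (E\<inverse>) v" "S \<times> F \<subseteq> E" "\<And>w. w \<in> nbr E u - K \<Longrightarrow> nbr (E\<inverse>) w \<inter> H = S"
proof -
  have uU: "u \<in> U" using u by (simp add: inner_def)
  then have uv: "(u, v) \<notin> E" "u < n" using u(2) baseD(1)[OF U uU] by auto
  then obtain S T where ST: "S \<subseteq> nbr (E\<inverse>) v" "T \<subseteq> nbr E u" "S \<times> T \<subseteq> E"
      "card S = s - 1 \<and> card T = t - 1 \<or> card S = t - 1 \<and> card T = s - 1"
    using sat[OF uv(2) v(1) uv(1)] by blast
  have ge: "s - 1 \<le> card S" "s - 1 \<le> card T" "s - 1 < t - 1" using ST(4) s_pos s_less_t by auto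
  have nT: "\<not> T \<subseteq> K"
  proof
    assume TK: "T \<subseteq> K"
    have T: "T = F" "card T = s - 1" using base_high_eq[OF U uU ST(2) TK ge(2)] F[OF uU] by auto
    then have "card S = t - 1" using ST(4) ge(3) by auto
    moreover have "S \<subseteq> nbr (E\<inverse>) v \<inter> cnb n (E\<inverse>) F"
      using ST(1,3) nbr_lessThan(2)[of v] by (auto simp: cnb_def T)
    then have "card S \<le> card (nbr (E\<inverse>) v \<inter> cnb n (E\<inverse>) F)" by (intro card_mono) auto
    ultimately show False using v by (simp add: rich_def)
  qed
  then obtain w0 where w0: "w0 \<in> T" "w0 \<notin> K" by blast
  then have "w0 \<in> inner (E\<inverse>) H V U" using ST(2) u(1) by (auto simp: inner_def)
  then have w0V: "w0 \<in> V" "nbr (E\<inverse>) w0 - H \<subseteq> U" by (auto simp: inner_def)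
  have SH: "S \<subseteq> H"
  proof
    fix x assume x: "x \<in> S"
    have xw: "(x, w0) \<in> E" "(x, v) \<in> E" "(u, w0) \<in> E" using x w0 ST(1-3) by auto
    show "x \<in> H"
    proof (rule ccontr)
      assume "x \<notin> H"
      then have "x \<in> U" using xw w0V by auto
      then have "u \<in> reach (E\<inverse>) U V v"
        using reachI[of v x "E\<inverse>" U w0 V u] xw w0V(1) by simp
      then show False using u(2) by simp
    qed
  qed
  have Sw0: "S \<subseteq> nbr (E\<inverse>) w0" using ST(3) w0(1) by auto
  have "card S = s - 1" by (rule base_high_eq'(2)[OF V w0V(1) Sw0 SH ge(1)])
  then have T: "T = nbr E u" using base_nbr_eq[OF U uU ST(2)] ST(4) ge(3) by auto
  show ?thesis
  proof (rule that[OF ST(1)])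
    show "S \<times> F \<subseteq> E" using ST(3) T F[OF uU] by auto
    fix w assume w: "w \<in> nbr E u - K"
    then have "w \<in> V" using u(1) by (auto simp: inner_def)
    moreover have "w \<in> T" using w T by blast
    then have "S \<subseteq> nbr (E\<inverse>) w" using ST(3) by auto
    ultimately show "nbr (E\<inverse>) w \<inter> H = S" using base_high_eq'(1)[OF V _ _ SH ge(1), of w] by simp
  qed
qed

end

context dense_sat_graph
begin

text \<open>A vertex \<open>v0\<close> that is not rich is joined to the common high neighbourhood \<open>\<gamma> u\<close> of the low neighbours of
  almost every typical \<open>u\<close>. As \<open>v0\<close> has at most \<open>t - 2\<close> neighbours joined to \<open>F\<close>, boundedly many sets
  occur as \<open>\<gamma> u\<close>, and the most popular one serves as \<open>G\<close>.\<close>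

lemma core_exists:
  assumes U: "base_U H K U \<mu>" and V: "base_V K H V \<mu>"
    and F: "\<And>u. u \<in> U \<Longrightarrow> nbr E u \<inter> K = F" and "finite H"
    and n: "2 ^ t * t ^ 4 + card H + t ^ 4 * \<mu> + t ^ 6 < n"
  shows "(\<forall>v<n. v \<notin> F \<longrightarrow> v \<in> rich n t E F) \<or> (\<exists>G. core F G)"
proof (cases "\<forall>v<n. v \<notin> F \<longrightarrow> v \<in> rich n t E F")
  case False
  define poor where "poor = (\<lambda>v. v < n \<and> v \<notin> F \<and> v \<notin> rich n t E F)"
  define near where "near = (\<lambda>v. (nbr (E\<inverse>) v \<inter> U) \<union> reach (E\<inverse>) U V v)"
  define U3 where "U3 = inner E K U (inner (E\<inverse>) H V U)"
  obtain v0 where v0: "poor v0" using False by (auto simp: poor_def)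
  have near: "card (near v) \<le> t ^ 3" "finite (near v)" "card (nbr (E\<inverse>) v \<inter> cnb n (E\<inverse>) F) \<le> t - 2"
    if "poor v" for v
    using poor_vertex_near[OF U V F] that by (auto simp: poor_def near_def)
  have joined: "\<exists>S. S \<subseteq> nbr (E\<inverse>) v \<and> S \<times> F \<subseteq> E \<and> (\<forall>w\<in>nbr E u - K. nbr (E\<inverse>) w \<inter> H = S)"
    if "poor v" "u \<in> U3" "u \<notin> near v" for u v
    using poor_vertex_joined[OF U V F, of v u] that unfolding poor_def near_def U3_def by metis
  have U3U: "U3 \<subseteq> U" by (auto simp: U3_def inner_def)

  \<comment> \<open>Low neighbours of \<open>X2\<close> lie in \<open>V3\<close>, and low neighbours
    of \<open>V3\<close> lie in \<open>X0\<close>, where \<open>v0\<close> controls the sets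
    \<open>\<gamma> u\<close>.\<close>
  define X0 where "X0 = U3 - near v0"
  define V3 where "V3 = inner (E\<inverse>) H V X0"
  define X2 where "X2 = inner E K X0 V3"
  \<comment> \<open>For \<open>u\<close> in \<open>X0\<close> all sets in this union coincide; the
    union only names their common value.\<close>
  define \<gamma> where "\<gamma> = (\<lambda>u. \<Union>w\<in>nbr E u - K. nbr (E\<inverse>) w \<inter> H)"
  have X0: "\<gamma> u \<subseteq> nbr (E\<inverse>) v0 \<inter> cnb n (E\<inverse>) F" "\<gamma> u \<times> F \<subseteq> E"
    "\<And>w. w \<in> nbr E u - K \<Longrightarrow> nbr (E\<inverse>) w \<inter> H = \<gamma> u" if u: "u \<in> X0" for u
  proof -
    obtain S where S: "S \<subseteq> nbr (E\<inverse>) v0" "S \<times> F \<subseteq> E" "\<forall>w\<in>nbr E u - K. nbr (E\<inverse>) w \<inter> H = S"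
      using joined[OF v0, of u] u by (auto simp: X0_def)
    have "u \<in> U" using u U3U by (auto simp: X0_def)
    then obtain w where "w \<in> nbr E u - K" by (rule base_low_nbr[OF U])
    then have \<gamma>: "\<gamma> u = S" using S(3) unfolding \<gamma>_def by blast
    show "\<gamma> u \<subseteq> nbr (E\<inverse>) v0 \<inter> cnb n (E\<inverse>) F"
      using S(1,2) nbr_lessThan(2)[of v0] unfolding \<gamma> by (auto simp: cnb_def)
    show "\<gamma> u \<times> F \<subseteq> E" "\<And>w. w \<in> nbr E u - K \<Longrightarrow> nbr (E\<inverse>) w \<inter> H = \<gamma> u"
      using S unfolding \<gamma> by auto
  qed

  have bV2: "base_V K H (inner (E\<inverse>) H V U) (t * \<mu>)" by (rule base_inner'[OF V U])
  have tmu: "\<mu> \<le> t * \<mu>" using s_less_t by simp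
  have "base_U H K U3 (t * (t * \<mu>))"
    unfolding U3_def by (rule base_inner[OF base_mono[OF U tmu] bV2])
  then have "base_U H K X0 (t * (t * \<mu>) + (t - 1) * t ^ 3)"
  proof (rule base_shrink)
    have "card (U3 - X0) \<le> card (near v0)" using near(2)[OF v0] by (intro card_mono) (auto simp: X0_def)
    then show "card (U3 - X0) \<le> t ^ 3" using near(1)[OF v0] by simp
  qed (auto simp: X0_def)
  moreover define \<nu> where "\<nu> = t * (t * \<mu>) + (t - 1) * t ^ 3"
  ultimately have bX0: "base_U H K X0 \<nu>" by simp
  have "\<mu> \<le> \<nu>" using tmu s_less_t by (simp add: \<nu>_def trans_le_add1)
  then have bV3: "base_V K H V3 (t * \<nu>)"
    unfolding V3_def by (intro base_inner'[OF base_mono'[OF V] bX0])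
  have "\<nu> \<le> t * \<nu>" using s_less_t by simp
  then have "base_U H K X2 (t * (t * \<nu>))"
    unfolding X2_def by (intro base_inner[OF base_mono[OF bX0] bV3])
  then have "n \<le> card X2 + card H + t * (t * \<nu>)" by (rule base_size) fact
  moreover have "t * (t * \<nu>) \<le> t ^ 4 * \<mu> + t ^ 6"
    by (simp add: \<nu>_def algebra_simps power_numeral_reduce diff_mult_distrib)
  ultimately have cX2: "2 ^ t * t ^ 4 < card X2" using n by simp

  have "\<exists>G\<in>Pow (nbr (E\<inverse>) v0 \<inter> cnb n (E\<inverse>) F). t ^ 4 < card {u \<in> X2. \<gamma> u = G}"
  proof (rule card_vimage_pigeonhole)
    show "finite X2" by (rule base_finite) fact
    show "\<gamma> ` X2 \<subseteq> Pow (nbr (E\<inverse>) v0 \<inter> cnb n (E\<inverse>) F)" using X0(1) by (auto simp: X2_def inner_def)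
    have "card (Pow (nbr (E\<inverse>) v0 \<inter> cnb n (E\<inverse>) F)) \<le> 2 ^ t"
      using near(3)[OF v0] by (subst card_Pow) auto
    then have "card (Pow (nbr (E\<inverse>) v0 \<inter> cnb n (E\<inverse>) F)) * t ^ 4 \<le> 2 ^ t * t ^ 4" by (rule mult_le_mono1)
    then show "card (Pow (nbr (E\<inverse>) v0 \<inter> cnb n (E\<inverse>) F)) * t ^ 4 < card X2" using cX2 by (rule le_less_trans)
  qed simp
  then obtain G where G: "t ^ 4 < card {u \<in> X2. \<gamma> u = G}" by blast
  define \<Phi> where "\<Phi> = {u \<in> X2. \<gamma> u = G}"
  define VG where "VG = {v \<in> V3. nbr (E\<inverse>) v \<inter> H = G}"
  have fVG: "finite VG" using V by (auto simp: VG_def V3_def inner_def base_def intro: finite_subset)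
  have VGV: "VG \<subseteq> V" by (auto simp: VG_def V3_def inner_def)
  have \<Phi>: "u \<in> U3" "u \<in> X0" "\<gamma> u = G" "nbr E u - K \<subseteq> VG" if "u \<in> \<Phi>" for u
  proof -
    have u: "u \<in> X0" "\<gamma> u = G" "nbr E u - K \<subseteq> V3" using that by (auto simp: \<Phi>_def X2_def inner_def)
    then show "u \<in> U3" "u \<in> X0" "\<gamma> u = G" by (auto simp: X0_def)
    show "nbr E u - K \<subseteq> VG" using X0(3)[OF u(1)] u(2,3) unfolding VG_def by blast
  qed
  have "t ^ 4 < card \<Phi>" using G by (simp add: \<Phi>_def)
  moreover have "t ^ 3 \<le> t ^ 4" using s_less_t by (intro power_increasing) auto
  ultimately have c\<Phi>: "t ^ 3 < card \<Phi>" by simp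
  then have "\<Phi> \<noteq> {}" by auto
  then obtain u1 where u1: "u1 \<in> \<Phi>" by blast
  \<comment> \<open>\<open>VG\<close> inherits its size from \<open>\<Phi>\<close>: every member of
    \<open>\<Phi>\<close> has a low neighbour in \<open>VG\<close>, and degrees there are below
    \<open>t\<close>.\<close>
  have "\<Phi> \<subseteq> (\<Union>v\<in>VG. nbr (E\<inverse>) v)"
  proof
    fix u assume u: "u \<in> \<Phi>"
    then have "u \<in> U" using \<Phi>(1) U3U by blast
    then obtain w where "w \<in> nbr E u - K" by (rule base_low_nbr[OF U])
    then show "u \<in> (\<Union>v\<in>VG. nbr (E\<inverse>) v)" using \<Phi>(4)[OF u] by auto
  qed
  then have "card \<Phi> \<le> card (\<Union>v\<in>VG. nbr (E\<inverse>) v)" using fVG by (intro card_mono) auto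
  also have "\<dots> \<le> card VG * t"
    using baseD'(3)[OF V] VGV fVG by (intro card_UN_le_mult) auto
  finally have "card \<Phi> \<le> card VG * t" .
  moreover have "t ^ 4 = t ^ 3 * t" by (simp add: power_numeral_reduce)
  ultimately have "t ^ 3 * t < card VG * t" using \<open>t ^ 4 < card \<Phi>\<close> by linarith
  then have cVG: "t ^ 3 < card VG" by simp
  then have "VG \<noteq> {}" by auto
  then obtain v1 where v1: "v1 \<in> VG" by blast
  have cG: "card G = s - 1" using baseD'(4)[OF V, of v1] v1 VGV by (auto simp: VG_def)
  have GU: "G \<subseteq> {..<n}" using v1 nbr_lessThan(2)[of v1] by (auto simp: VG_def)
  have "G \<subseteq> H" using v1 by (auto simp: VG_def)
  have GF: "G \<times> F \<subseteq> E" using X0(2)[of u1] \<Phi>[OF u1] by simp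
  have "nbr E u1 \<inter> K = F" "u1 \<in> U" using F \<Phi>(1)[OF u1] U3U by auto
  then have Fn: "F \<subseteq> {..<n}" "card F = s - 1"
    using nbr_lessThan(1)[of u1] baseD(4)[OF U] by auto
  \<comment> \<open>\<open>\<Phi>\<close> is too large to lie near \<open>v\<close>. A member
    \<open>u\<close> far from \<open>v\<close> shows that \<open>v\<close> is joined to
    \<open>\<gamma> u\<close>, which is \<open>G\<close>.\<close>
  have "v \<in> cnb n E G" if v: "poor v" for v
  proof -
    have "\<not> \<Phi> \<subseteq> near v" using c\<Phi> near[OF v] card_mono[of "near v" \<Phi>] by auto
    then obtain u where u: "u \<in> \<Phi>" "u \<notin> near v" by blast
    obtain S where S: "S \<subseteq> nbr (E\<inverse>) v" "\<forall>w\<in>nbr E u - K. nbr (E\<inverse>) w \<inter> H = S"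
      using joined[OF v \<Phi>(1)[OF u(1)] u(2)] by blast
    have "u \<in> U" using \<Phi>(1)[OF u(1)] U3U by blast
    then obtain w where "w \<in> nbr E u - K" by (rule base_low_nbr[OF U])
    then have "S = G" using S(2) X0(3)[OF \<Phi>(2)[OF u(1)]] \<Phi>(3)[OF u(1)] by blast
    then show ?thesis using S(1) v by (auto simp: cnb_def poor_def)
  qed
  \<comment> \<open>The mirror image, with \<open>VG\<close> and \<open>G\<close> in place of
    \<open>U\<close> and \<open>F\<close>. For \<open>v\<close> in \<open>VG\<close> far from
    \<open>u\<close>, either \<open>S\<close> is high, so \<open>S = G\<close> and \<open>T\<close>
    makes \<open>u\<close> rich, or \<open>S\<close> has a low member, which forces \<open>T\<close>
    to be high, so \<open>T = F\<close> and \<open>u\<close> is joined to \<open>F\<close>.\<close>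
  moreover have "u \<in> cnb n (E\<inverse>) F \<or> u \<in> rich n t (E\<inverse>) G" if u: "u < n" "u \<notin> G" for u
  proof (rule ccontr)
    assume neg: "\<not> ?thesis"
    have c: "card (nbr E u \<inter> cnb n E G) \<le> t - 2"
      using neg u by (auto simp: rich_def)
    have "VG \<subseteq> cnb n E G" using VGV baseD'(1)[OF V] by (fastforce simp: VG_def cnb_def)
    have "card (reach E (cnb n E G \<inter> V) U u) \<le> (t - 2) * ((t - 1) * (t - 1))"
    proof (rule card_reach)
      have "card (nbr E u \<inter> (cnb n E G \<inter> V)) \<le> card (nbr E u \<inter> cnb n E G)" by (intro card_mono) auto
      then show "card (nbr E u \<inter> (cnb n E G \<inter> V)) \<le> t - 2" using c by simp
    qed (use baseD(3)[OF U] baseD'(3)[OF V] in auto)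
    then have "card ((nbr E u \<inter> cnb n E G) \<union> reach E (cnb n E G \<inter> V) U u) \<le> (t - 2) + (t - 2) * ((t - 1) * (t - 1))"
      using c card_Un_le[of "nbr E u \<inter> cnb n E G" "reach E (cnb n E G \<inter> V) U u"] by linarith
    also have "\<dots> \<le> t ^ 3"
    proof -
      obtain m where "t = m + 2" using s_pos s_less_t by (metis One_nat_def Suc_1 Suc_leI add.commute le_Suc_ex le_less_trans)
      then show ?thesis by (simp add: power3_eq_cube algebra_simps)
    qed
    finally have "\<not> VG \<subseteq> (nbr E u \<inter> cnb n E G) \<union> reach E (cnb n E G \<inter> V) U u"
      using cVG card_mono[of "(nbr E u \<inter> cnb n E G) \<union> reach E (cnb n E G \<inter> V) U u" VG] by auto
    then obtain v where v: "v \<in> VG" "v \<notin> nbr E u" "v \<notin> reach E (cnb n E G \<inter> V) U u"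
      using \<open>VG \<subseteq> cnb n E G\<close> by blast
    have vV: "v \<in> V" "v < n" "v \<notin> K" using v(1) VGV baseD'(1,2)[OF V, of v] by auto
    obtain S T where ST: "S \<subseteq> nbr (E\<inverse>) v" "T \<subseteq> nbr E u" "S \<times> T \<subseteq> E"
        "card S = s - 1 \<and> card T = t - 1 \<or> card S = t - 1 \<and> card T = s - 1"
      using sat[OF u(1) vV(2)] v(2) unfolding mem_nbr by blast
    have ge: "s - 1 \<le> card S" "s - 1 \<le> card T" "s - 1 < t - 1" using ST(4) s_pos s_less_t by auto
    show False
    proof (cases "S \<subseteq> H")
      case True
      have S: "S = G" "card S = s - 1"
        using base_high_eq'[OF V vV(1) ST(1) True ge(1)] v(1) by (auto simp: VG_def)
      then have "card T = t - 1" using ST(4) ge(3) by auto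
      moreover have "T \<subseteq> nbr E u \<inter> cnb n E G"
        using ST(2,3) nbr_lessThan(1)[of u] S(1) by (auto simp: cnb_def)
      then have "card T \<le> card (nbr E u \<inter> cnb n E G)" by (intro card_mono) auto
      ultimately show False using neg u by (simp add: rich_def)
    next
      case False
      then obtain x where x: "x \<in> S" "x \<notin> H" by blast
      have "x \<in> nbr (E\<inverse>) v - H" using x ST(1) by auto
      then have xX: "x \<in> X0" using v(1) by (auto simp: VG_def V3_def inner_def)
      have xU: "x \<in> U" using xX U3U by (auto simp: X0_def)
      have "v \<in> nbr E x - K" using \<open>x \<in> nbr (E\<inverse>) v - H\<close> vV(3) by simp
      then have \<gamma>x: "\<gamma> x = G" using X0(3)[OF xX, of v] v(1) by (auto simp: VG_def)
      have Tx: "T \<subseteq> nbr E x" using ST(3) x(1) by auto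
      have TK: "T \<subseteq> K"
      proof
        fix w assume w: "w \<in> T"
        show "w \<in> K"
        proof (rule ccontr)
          assume "w \<notin> K"
          then have wx: "w \<in> nbr E x - K" using w Tx by blast
          then have "nbr (E\<inverse>) w \<inter> H = G" using X0(3)[OF xX] \<gamma>x by simp
          moreover have "w < n" using wx nbr_lessThan(1)[of x] by auto
          ultimately have "w \<in> cnb n E G" by (auto simp: cnb_def)
          moreover have "w \<in> inner (E\<inverse>) H V U" using wx xX by (auto simp: X0_def U3_def inner_def)
          then have "w \<in> V" by (simp add: inner_def)
          ultimately have "v \<in> reach E (cnb n E G \<inter> V) U u"
            using reachI[of u w E "cnb n E G \<inter> V" x U v] subsetD[OF ST(2) w] wx xU \<open>v \<in> nbr E x - K\<close> by simp
          then show False using v(3) by simp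
        qed
      qed
      have "T = F" using base_high_eq(1)[OF U xU Tx TK ge(2)] F[OF xU] by simp
      then have "u \<in> cnb n (E\<inverse>) F" using ST(2) u(1) by (auto simp: cnb_def)
      then show False using neg by simp
    qed
  qed
  ultimately have "core F G"
    unfolding core_def poor_def using Fn cG GU GF by blast
  then show ?thesis by blast
qed blast

end

subsection \<open>Few deficient vertices in both classes\<close>

definition deficient :: "nat \<Rightarrow> nat \<Rightarrow> (nat \<times> nat) set \<Rightarrow> nat set \<Rightarrow> nat set" where
  "deficient n s E K = {u. u < n \<and> card (nbr E u \<inter> K) < s - 1}"

definition abundant :: "nat \<Rightarrow> nat \<Rightarrow> (nat \<times> nat) set \<Rightarrow> nat set \<Rightarrow> nat set" where
  "abundant n s E K = {u. u < n \<and> s \<le> card (nbr E u \<inter> K)}"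

text \<open>The truncated difference is exact in \<open>dense_sat_graph\<close>, where all degrees
  are at least \<open>t - 1\<close>.\<close>

definition excess :: "nat \<Rightarrow> nat \<Rightarrow> (nat \<times> nat) set \<Rightarrow> nat set \<Rightarrow> nat" where
  "excess n t E H = (\<Sum>u\<in>{..<n} - H. card (nbr E u) - (t - 1))"

lemma finite_deficient_abundant [simp]: "finite (deficient n s E K)" "finite (abundant n s E K)"
  by (auto simp: deficient_def abundant_def)

context dense_sat_graph
begin

text \<open>Compared with \<open>(s + t - 2) * n\<close>, the edge count by degrees outside
  \<open>H\<close> and incidence with \<open>H\<close> loses \<open>t - 1\<close> for each member of
  \<open>H\<close> and at most \<open>s - 1\<close> for each deficient vertex; it gains the excess
  and at least one for each abundant vertex.\<close>

lemma excess_bound: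
  assumes H: "H \<subseteq> {..<n}" and e: "card E \<le> (s + t - 2) * n"
  shows "excess n t E H + card (abundant n s (E\<inverse>) H) \<le> (t - 1) * card H + (s - 1) * card (deficient n s (E\<inverse>) H)"
proof -
  have fH: "finite H" using H finite_subset by blast
  have cH: "card H \<le> n" using card_mono[OF _ H] by simp
  have "(\<Sum>u\<in>{..<n} - H. card (nbr E u)) = (\<Sum>u\<in>{..<n} - H. (card (nbr E u) - (t - 1)) + (t - 1))"
    using deg by (intro sum.cong) auto
  then have 1: "(\<Sum>u\<in>{..<n} - H. card (nbr E u)) = excess n t E H + (t - 1) * (n - card H)"
    using H fH by (simp add: sum.distrib excess_def card_Diff_subset mult.commute)
  have "(\<Sum>v<n. (s - 1) + (if v \<in> abundant n s (E\<inverse>) H then 1 else 0)) \<le>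
      (\<Sum>v<n. card (nbr (E\<inverse>) v \<inter> H) + (if v \<in> deficient n s (E\<inverse>) H then s - 1 else 0))"
    using s_pos by (intro sum_mono) (auto simp: abundant_def deficient_def)
  moreover have "{..<n} \<inter> abundant n s (E\<inverse>) H = abundant n s (E\<inverse>) H" "{..<n} \<inter> deficient n s (E\<inverse>) H = deficient n s (E\<inverse>) H"
    by (auto simp: abundant_def deficient_def)
  ultimately have 2: "(s - 1) * n + card (abundant n s (E\<inverse>) H) \<le>
      (\<Sum>v<n. card (nbr (E\<inverse>) v \<inter> H)) + (s - 1) * card (deficient n s (E\<inverse>) H)"
    by (simp add: sum.distrib sum.If_cases mult.commute)
  have "s + t - 2 = (s - 1) + (t - 1)" using s_pos s_less_t by simp
  then have "(s + t - 2) * n = (s - 1) * n + (t - 1) * n" by (simp only: add_mult_distrib)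
  moreover have "(t - 1) * (n - card H) + (t - 1) * card H = (t - 1) * n"
    using cH by (metis add_mult_distrib2 le_add_diff_inverse2)
  ultimately show ?thesis using card_E_split[OF H] 1 2 e by linarith
qed

lemmas excess_bound' = dense_sat_graph.excess_bound[OF swap_dense, unfolded converse_converse card_inverse]

definition typical :: "nat set \<Rightarrow> nat set \<Rightarrow> nat set" where
  "typical H K = {u. u < n \<and> u \<notin> H \<and> card (nbr E u) = t - 1 \<and> card (nbr E u \<inter> K) = s - 1}"

lemma sum_degree_le:
  assumes "A \<subseteq> {..<n} - H"
  shows "(\<Sum>u\<in>A. card (nbr E u)) \<le> excess n t E H + (t - 1) * card A"
proof -
  have "(\<Sum>u\<in>A. card (nbr E u)) = (\<Sum>u\<in>A. (card (nbr E u) - (t - 1)) + (t - 1))"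
    using assms deg by (intro sum.cong) auto
  also have "\<dots> = (\<Sum>u\<in>A. card (nbr E u) - (t - 1)) + (t - 1) * card A" by (simp add: sum.distrib mult.commute)
  also have "(\<Sum>u\<in>A. card (nbr E u) - (t - 1)) \<le> excess n t E H"
    unfolding excess_def using assms by (intro sum_mono2) auto
  finally show ?thesis by simp
qed

lemma card_degree_ge_t_le: "card {u. u < n \<and> u \<notin> H \<and> t - 1 < card (nbr E u)} \<le> excess n t E H"
proof -
  have "card {u. u < n \<and> u \<notin> H \<and> t - 1 < card (nbr E u)} = (\<Sum>u\<in>{u. u < n \<and> u \<notin> H \<and> t - 1 < card (nbr E u)}. 1)" by simp
  also have "\<dots> \<le> (\<Sum>u\<in>{u. u < n \<and> u \<notin> H \<and> t - 1 < card (nbr E u)}. card (nbr E u) - (t - 1))"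
    by (intro sum_mono) auto
  also have "\<dots> \<le> excess n t E H"
    unfolding excess_def by (intro sum_mono2) auto
  finally show ?thesis .
qed

lemma typical_base:
  "base_U H K (typical H K)
    (excess n t E H + (t - 1) * (excess n t E H + card (abundant n s E K) + card (deficient n s E K)))"
proof -
  let ?A = "{..<n} - H - typical H K"
  let ?B = "{u. u < n \<and> u \<notin> H \<and> t - 1 < card (nbr E u)}"
  have "?A \<subseteq> ?B \<union> abundant n s E K \<union> deficient n s E K"
  proof
    fix u assume u: "u \<in> ?A"
    then have "t - 1 \<le> card (nbr E u)" using deg by simp
    then show "u \<in> ?B \<union> abundant n s E K \<union> deficient n s E K"
      using u by (auto simp: typical_def abundant_def deficient_def)
  qed
  then have "card ?A \<le> card (?B \<union> abundant n s E K \<union> deficient n s E K)" by (intro card_mono) auto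
  also have "\<dots> \<le> card ?B + card (abundant n s E K) + card (deficient n s E K)"
    using card_Un_le[of "?B \<union> abundant n s E K" "deficient n s E K"] card_Un_le[of ?B "abundant n s E K"] by linarith
  finally have "card ?A \<le> excess n t E H + card (abundant n s E K) + card (deficient n s E K)"
    using card_degree_ge_t_le[of H] by linarith
  then have "(t - 1) * card ?A \<le> (t - 1) * (excess n t E H + card (abundant n s E K) + card (deficient n s E K))"
    by (rule mult_le_mono2)
  then have "(\<Sum>u\<in>?A. card (nbr E u)) \<le> excess n t E H + (t - 1) * (excess n t E H + card (abundant n s E K) + card (deficient n s E K))"
    using sum_degree_le[of ?A H] by (meson Diff_subset add_left_mono order_trans)
  then show ?thesis by (auto simp: base_def typical_def)
qed

text \<open>\<open>excess_bound\<close> controls the excess in the first class by the deficient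
  vertices of the second, and its mirror image controls the abundant vertices of the first class by
  the deficient ones there. So few deficient vertices in both classes leave few vertices that are
  not typical.\<close>

lemma typical_base_small:
  assumes H: "H \<subseteq> {..<n}" and K: "K \<subseteq> {..<n}" and e: "card E \<le> (s + t - 2) * n"
    and m: "card H \<le> m" "card K \<le> m" "card (deficient n s E K) \<le> m" "card (deficient n s (E\<inverse>) H) \<le> m"
  shows "base_U H K (typical H K) (8 * t ^ 2 * m)"
proof -
  have b: "(t - 1) * x + (s - 1) * y \<le> 2 * t * m" if "x \<le> m" "y \<le> m" for x y
  proof -
    have "(t - 1) * x + (s - 1) * y \<le> t * m + t * m"
      using that s_less_t by (intro add_mono mult_mono) auto
    then show ?thesis by simp
  qed
  have 1: "excess n t E H \<le> 2 * t * m"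
    using excess_bound[OF H e] b[of "card H" "card (deficient n s (E\<inverse>) H)"] m by linarith
  have 2: "card (abundant n s E K) \<le> 2 * t * m"
    using excess_bound'[OF K e] b[of "card K" "card (deficient n s E K)"] m by linarith
  have "m \<le> t * m" using s_less_t by simp
  then have "excess n t E H + card (abundant n s E K) + card (deficient n s E K) \<le> 5 * t * m"
    using 1 2 m by linarith
  then have "excess n t E H + (t - 1) * (excess n t E H + card (abundant n s E K) + card (deficient n s E K))
      \<le> 2 * t * m + t * (5 * t * m)"
    using 1 by (intro add_mono mult_mono) auto
  also have "\<dots> \<le> 8 * t ^ 2 * m"
  proof -
    have "t * m \<le> t * (t * m)" using s_less_t by simp
    then have "2 * (t * m) + 5 * (t * (t * m)) \<le> 8 * (t * (t * m))" by linarith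
    then show ?thesis by (simp add: power2_eq_square algebra_simps)
  qed
  finally show ?thesis by (rule base_mono[OF typical_base])
qed

text \<open>Once the vertices with high neighbourhood other than \<open>F\<close> are discarded,
  \<open>core_exists\<close> leaves two cases, and the edge bound is known in both.\<close>

lemma bound_if_const:
  assumes U: "base_U H K U \<mu>" and V: "base_V K H V \<mu>" and "finite H"
    and F: "card {u \<in> U. nbr E u \<inter> K \<noteq> F} \<le> 2 * t ^ 4"
    and n: "2 ^ t * t ^ 4 + card H + t ^ 4 * (\<mu> + 2 * t ^ 5) + t ^ 6 < n"
  shows "int (s + t - 2) * int n - int (s - 1) * int (t - 1) - (int (s - 1))\<^sup>2 div 4 \<le> int (card E)"
proof -
  define U' where "U' = {u \<in> U. nbr E u \<inter> K = F}"
  have "U - U' = {u \<in> U. nbr E u \<inter> K \<noteq> F}" by (auto simp: U'_def)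
  then have "base_U H K U' (\<mu> + (t - 1) * (2 * t ^ 4))"
    using F by (intro base_shrink[OF U]) (auto simp: U'_def)
  moreover have "(t - 1) * (2 * t ^ 4) \<le> t * (2 * t ^ 4)" by (intro mult_le_mono1) simp
  then have le: "(t - 1) * (2 * t ^ 4) \<le> 2 * t ^ 5" by (simp add: power_numeral_reduce)
  ultimately have U': "base_U H K U' (\<mu> + 2 * t ^ 5)" by (auto intro: base_mono)
  have V': "base_V K H V (\<mu> + 2 * t ^ 5)" by (rule base_mono'[OF V]) simp
  have "card H + (\<mu> + 2 * t ^ 5) \<le> card H + t ^ 4 * (\<mu> + 2 * t ^ 5)"
    using s_less_t mult_le_mono1[of 1 "t ^ 4" "\<mu> + 2 * t ^ 5"] by simp
  also have "\<dots> \<le> 2 ^ t * t ^ 4 + card H + t ^ 4 * (\<mu> + 2 * t ^ 5) + t ^ 6" by linarith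
  also note n
  finally have "0 < card U'" using base_size[OF U' \<open>finite H\<close>] by linarith
  then have "U' \<noteq> {}" by auto
  then obtain u where u: "u \<in> U'" by blast
  have "F = nbr E u \<inter> K" using u by (simp add: U'_def)
  then have F': "F \<subseteq> {..<n}" "card F = s - 1"
    using nbr_lessThan(1)[of u] baseD(4)[OF U' u] by auto
  have "(\<forall>v<n. v \<notin> F \<longrightarrow> v \<in> rich n t E F) \<or> (\<exists>G. core F G)"
    by (rule core_exists[OF U' V' _ \<open>finite H\<close> n]) (simp add: U'_def)
  then show ?thesis
  proof
    assume "\<forall>v<n. v \<notin> F \<longrightarrow> v \<in> rich n t E F"
    then have "int (s + t - 2) * int n - int (s - 1) * int (t - 1) \<le> int (card E)"
      using all_rich_bound[OF F'] by blast
    moreover have "0 \<le> (int (s - 1))\<^sup>2 div 4" by (simp add: pos_imp_zdiv_nonneg_iff)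
    ultimately show ?thesis by linarith
  qed (use core_bound in blast)
qed

lemmas bound_if_const' = dense_sat_graph.bound_if_const[OF swap_dense, unfolded converse_converse card_inverse]
lemmas typical_base_small' = dense_sat_graph.typical_base_small[OF swap_dense, unfolded converse_converse card_inverse]

lemma balanced_bound:
  assumes H: "H \<subseteq> {..<n}" and K: "K \<subseteq> {..<n}" and e: "card E \<le> (s + t - 2) * n"
    and m: "card H \<le> m" "card K \<le> m" "card (deficient n s E K) \<le> m" "card (deficient n s (E\<inverse>) H) \<le> m"
    and n: "2 ^ t * t ^ 4 + 2 * t ^ 9 + t ^ 6 + 9 * t ^ 8 * m < n"
  shows "int (s + t - 2) * int n - int (s - 1) * int (t - 1) - (int (s - 1))\<^sup>2 div 4 \<le> int (card E)"
proof -
  have fin: "finite H" "finite K" using H K finite_subset by blast+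
  define U where "U = typical H K"
  define V where "V = dense_sat_graph.typical n s t (E\<inverse>) K H"
  define \<mu> where "\<mu> = 8 * t ^ 2 * m"
  have U: "base_U H K U \<mu>" unfolding U_def \<mu>_def by (rule typical_base_small[OF H K e m])
  have V: "base_V K H V \<mu>" unfolding V_def \<mu>_def by (rule typical_base_small'[OF K H e m(2,1,4,3)])
  define U2 where "U2 = inner E K U V"
  define V2 where "V2 = inner (E\<inverse>) H V U"
  have 2: "base_U H K U2 (t * \<mu>)" "base_V K H V2 (t * \<mu>)"
    unfolding U2_def V2_def by (rule base_inner[OF U V], rule base_inner'[OF V U])
  define U3 where "U3 = inner E K U2 V2"
  define V3 where "V3 = inner (E\<inverse>) H V2 U2"
  have 3: "base_U H K U3 (t * (t * \<mu>))" "base_V K H V3 (t * (t * \<mu>))"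
    unfolding U3_def V3_def by (rule base_inner[OF 2], rule base_inner'[OF 2(2,1)])
  have t1: "m \<le> t ^ 8 * m" "t ^ 3 * m \<le> t ^ 8 * m" 
    using s_less_t by (auto intro!: mult_le_mono1 power_increasing)
  have "t * \<mu> = 8 * (t ^ 3 * m)" by (simp add: \<mu>_def power_numeral_reduce)
  then have "card H + t * \<mu> < n" using m(1) n t1 by linarith
  then have "U2 \<noteq> {}" using base_size[OF 2(1) fin(1)] by auto
  then obtain u0 where u0: "u0 \<in> U2" by blast
  \<comment> \<open>Two passes of \<open>inner\<close> multiply \<open>\<mu>\<close> by
    \<open>t ^ 2\<close>. The threshold of \<open>bound_if_const\<close> then needs
    \<open>8 * t ^ 8 * m\<close>, and the ninth \<open>t ^ 8 * m\<close> in the hypothesis pays for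
    \<open>H\<close> or \<open>K\<close>.\<close>
  have "t ^ 4 * (t * (t * \<mu>) + 2 * t ^ 5) = 8 * t ^ 8 * m + 2 * t ^ 9"
    by (simp add: \<mu>_def power_numeral_reduce algebra_simps)
  then have big: "2 ^ t * t ^ 4 + card H + t ^ 4 * (t * (t * \<mu>) + 2 * t ^ 5) + t ^ 6 < n"
      "2 ^ t * t ^ 4 + card K + t ^ 4 * (t * (t * \<mu>) + 2 * t ^ 5) + t ^ 6 < n"
    using m(1,2) n t1(1) by linarith+
  from high_nbrs_const[OF U V U2_def V2_def U3_def V3_def u0] show ?thesis
  proof (elim disjE exE)
    fix F assume "card {u \<in> U3. nbr E u \<inter> K \<noteq> F} \<le> 2 * t ^ 4"
    then show ?thesis using bound_if_const[OF 3 fin(1) _ big(1)] by simp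
  next
    fix G assume "card {v \<in> V3. nbr (E\<inverse>) v \<inter> H \<noteq> G} \<le> 2 * t ^ 4"
    then show ?thesis using bound_if_const'[OF 3(2,1) fin(2) _ big(2)] by simp
  qed
qed

end

subsection \<open>Many deficient vertices in one class\<close>

context dense_sat_graph
begin

text \<open>If both ends of a missing edge are deficient, then neither
  \<open>T \<subseteq> K\<close> nor \<open>S \<subseteq> H\<close>, so \<open>v\<close> is reached
  from \<open>u\<close> through low vertices. Hence one deficient \<open>u\<close> of bounded degree
  already limits the deficient vertices of the other class.\<close>

lemma deficient_converse_small:
  assumes H: "\<And>u. u < n \<Longrightarrow> u \<notin> H \<Longrightarrow> card (nbr E u) \<le> M"
    and K: "\<And>v. v < n \<Longrightarrow> v \<notin> K \<Longrightarrow> card (nbr (E\<inverse>) v) \<le> L"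
    and u: "u \<in> deficient n s E K" "u \<notin> H"
  shows "card (deficient n s (E\<inverse>) H) \<le> M + M * (L * M)"
proof -
  let ?A = "{..<n} - K" and ?B = "{..<n} - H"
  have un: "u < n" "card (nbr E u \<inter> K) < s - 1" using u by (auto simp: deficient_def)
  have "deficient n s (E\<inverse>) H \<subseteq> nbr E u \<union> reach E ?A ?B u"
  proof
    fix v assume v: "v \<in> deficient n s (E\<inverse>) H"
    then have vn: "v < n" "card (nbr (E\<inverse>) v \<inter> H) < s - 1" by (auto simp: deficient_def)
    show "v \<in> nbr E u \<union> reach E ?A ?B u"
    proof (rule ccontr)
      assume neg: "v \<notin> nbr E u \<union> reach E ?A ?B u"
      then obtain S T where ST: "S \<subseteq> nbr (E\<inverse>) v" "T \<subseteq> nbr E u" "S \<times> T \<subseteq> E"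
          "card S = s - 1 \<and> card T = t - 1 \<or> card S = t - 1 \<and> card T = s - 1"
        using sat[OF un(1) vn(1)] by auto
      have ge: "s - 1 \<le> card S" "s - 1 \<le> card T" using ST(4) s_less_t by auto
      have "\<not> T \<subseteq> K"
      proof
        assume "T \<subseteq> K"
        then have "card T \<le> card (nbr E u \<inter> K)" using ST(2) by (intro card_mono) auto
        then show False using un(2) ge(2) by simp
      qed
      moreover have "\<not> S \<subseteq> H"
      proof
        assume "S \<subseteq> H"
        then have "card S \<le> card (nbr (E\<inverse>) v \<inter> H)" using ST(1) by (intro card_mono) auto
        then show False using vn(2) ge(1) by simp
      qed
      ultimately obtain x w where x: "x \<in> S" "x \<notin> H" and w: "w \<in> T" "w \<notin> K" by blast
      have "(u, w) \<in> E" "(x, v) \<in> E" "(x, w) \<in> E" using ST(1-3) x(1) w(1) by auto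
      then have "v \<in> reach E ?A ?B u"
        using reachI[of u w E ?A x ?B v] x(2) w(2) sub by auto
      then show False using neg by simp
    qed
  qed
  then have "card (deficient n s (E\<inverse>) H) \<le> card (nbr E u \<union> reach E ?A ?B u)" by (intro card_mono) auto
  also have "\<dots> \<le> card (nbr E u) + card (reach E ?A ?B u)" by (rule card_Un_le)
  also have "\<dots> \<le> M + M * (L * M)"
  proof (rule add_mono)
    show "card (nbr E u) \<le> M" using H un(1) u(2) by blast
    moreover have "card (nbr E u \<inter> ?A) \<le> card (nbr E u)" by (intro card_mono) auto
    ultimately show "card (reach E ?A ?B u) \<le> M * (L * M)" using H K by (intro card_reach) auto
  qed
  finally show ?thesis .
qed

text \<open>As \<open>u\<close> is deficient, \<open>T\<close> has a low member. For
  \<open>v\<close> out of reach this makes \<open>S\<close> high of size \<open>s - 1\<close>, so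
  \<open>T\<close> is the whole neighbourhood of \<open>u\<close> and \<open>S\<close> lies in the
  high neighbourhood \<open>G\<close> of one fixed low neighbour \<open>w0\<close>.\<close>

lemma almost_all_joined:
  assumes U1: "\<And>u. u \<in> U1 \<Longrightarrow> u < n \<and> card (nbr E u) = t - 1"
    and V1: "\<And>v. v \<in> V1 \<Longrightarrow> v < n \<and> card (nbr (E\<inverse>) v) \<le> L \<and> card (nbr (E\<inverse>) v \<inter> H) = s - 1 \<and> nbr (E\<inverse>) v - H \<subseteq> U1"
    and u: "u \<in> deficient n s E K" "u \<in> U1" "nbr E u - K \<subseteq> V1" and L: "1 \<le> L"
  obtains G where "G \<subseteq> H" "G \<subseteq> {..<n}" "card G = s - 1" "card ({..<n} - cnb n E G) \<le> t ^ 2 * L"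
proof -
  have un: "u < n" "card (nbr E u \<inter> K) < s - 1" "card (nbr E u) = t - 1"
    using u(1) U1[OF u(2)] by (auto simp: deficient_def)
  have "\<not> nbr E u \<subseteq> K"
  proof
    assume "nbr E u \<subseteq> K"
    then have "nbr E u \<inter> K = nbr E u" by blast
    then show False using un s_less_t by simp
  qed
  then obtain w0 where w0: "w0 \<in> nbr E u - K" by blast
  define G where "G = nbr (E\<inverse>) w0 \<inter> H"
  have w0V: "w0 \<in> V1" using w0 u(3) by blast
  have G: "G \<subseteq> H" "G \<subseteq> {..<n}" "card G = s - 1" using V1[OF w0V] nbr_lessThan(2)[of w0] by (auto simp: G_def)
  have "{..<n} - cnb n E G \<subseteq> nbr E u \<union> reach E V1 U1 u"
  proof
    fix v assume v: "v \<in> {..<n} - cnb n E G"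
    show "v \<in> nbr E u \<union> reach E V1 U1 u"
    proof (rule ccontr)
      assume neg: "v \<notin> nbr E u \<union> reach E V1 U1 u"
      then obtain S T where ST: "S \<subseteq> nbr (E\<inverse>) v" "T \<subseteq> nbr E u" "S \<times> T \<subseteq> E"
          "card S = s - 1 \<and> card T = t - 1 \<or> card S = t - 1 \<and> card T = s - 1"
        using sat[OF un(1), of v] v by auto
      have ge: "s - 1 \<le> card S" "s - 1 \<le> card T" "s - 1 < t - 1" using ST(4) s_pos s_less_t by auto
      have "\<not> T \<subseteq> K"
      proof
        assume "T \<subseteq> K"
        then have "card T \<le> card (nbr E u \<inter> K)" using ST(2) by (intro card_mono) auto
        then show False using un(2) ge(2) by simp
      qed
      then obtain w where w: "w \<in> T" "w \<notin> K" by blast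
      have wV: "w \<in> V1" using w ST(2) u(3) by blast
      have SH: "S \<subseteq> H"
      proof
        fix x assume x: "x \<in> S"
        have xw: "(u, w) \<in> E" "(x, v) \<in> E" "(x, w) \<in> E" using ST(1-3) x w(1) by auto
        show "x \<in> H"
        proof (rule ccontr)
          assume "x \<notin> H"
          then have "x \<in> U1" using V1[OF wV] xw(3) by auto
          then show False using neg reachI[of u w E V1 x U1 v] xw wV by simp
        qed
      qed
      have "S \<subseteq> nbr (E\<inverse>) w \<inter> H" using SH ST(3) w(1) by auto
      then have "card S \<le> s - 1" using card_mono[of "nbr (E\<inverse>) w \<inter> H" S] V1[OF wV] by simp
      then have c: "card S = s - 1" "card T = t - 1" using ge ST(4) by auto
      have "T = nbr E u" using ST(2) c(2) un(3) by (intro card_seteq) auto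
      then have "w0 \<in> T" using w0 by blast
      then have "S \<subseteq> G" using ST(3) SH by (auto simp: G_def)
      then have "S = G" using c(1) G(3) by (intro card_seteq) (auto simp: G_def)
      then show False using ST(1) v by (auto simp: cnb_def)
    qed
  qed
  then have "card ({..<n} - cnb n E G) \<le> card (nbr E u \<union> reach E V1 U1 u)" by (intro card_mono) auto
  also have "\<dots> \<le> card (nbr E u) + card (reach E V1 U1 u)" by (rule card_Un_le)
  also have "\<dots> \<le> (t - 1) + (t - 1) * (L * (t - 1))"
  proof (rule add_mono)
    show "card (nbr E u) \<le> t - 1" using un(3) by simp
    moreover have "card (nbr E u \<inter> V1) \<le> card (nbr E u)" by (intro card_mono) auto
    ultimately show "card (reach E V1 U1 u) \<le> (t - 1) * (L * (t - 1))"
      using U1 V1 by (intro card_reach) auto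
  qed
  also have "\<dots> \<le> (t - 1) * L + (t - 1) * (L * (t - 1))" using L by simp
  also have "\<dots> = (t - 1) * (L * t)" using s_less_t by (cases t) (auto simp: algebra_simps)
  also have "\<dots> \<le> t * (L * t)" by (intro mult_le_mono1) simp
  also have "\<dots> = t ^ 2 * L" by (simp add: power2_eq_square)
  finally show ?thesis using that[OF G] by blast
qed

text \<open>Otherwise each far typical \<open>v\<close> has \<open>t - s\<close> neighbours in the set \<open>P\<close> of degree \<open>t - 1\<close> vertices with at
  least \<open>s - 1\<close> neighbours in \<open>K\<close>. These have at most \<open>t - s\<close> neighbours outside \<open>K\<close>, so \<open>P\<close> is at least
  as large as the set of such \<open>v\<close>, leaving no room for the deficient vertices.\<close>

lemma all_joined_or_rich:
  assumes U1: "\<And>u. u \<in> U1 \<Longrightarrow> u < n \<and> card (nbr E u) = t - 1"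
    and V1: "\<And>v. v \<in> V1 \<Longrightarrow> v < n \<and> v \<notin> K \<and> card (nbr (E\<inverse>) v) \<le> L \<and> card (nbr (E\<inverse>) v \<inter> H) = s - 1 \<and> nbr (E\<inverse>) v - H \<subseteq> U1"
    and U2: "\<And>u. u \<in> U2 \<Longrightarrow> u \<in> U1 \<and> nbr E u - K \<subseteq> V1"
    and V2: "\<And>v. v \<in> V2 \<Longrightarrow> v \<in> V1 \<and> nbr (E\<inverse>) v - H \<subseteq> U2"
    and G: "G \<subseteq> H" "card G = s - 1" "card ({..<n} - cnb n E G) \<le> a"
    and V2c: "n \<le> card V2 + d"
    and big: "d + a + t + (t + a) * (L * t) < card (deficient n s E K)"
    and u: "u < n" "u \<notin> G"
  shows "u \<in> rich n t (E\<inverse>) G"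
proof (rule ccontr)
  assume neg: "u \<notin> rich n t (E\<inverse>) G"
  have c: "card (nbr E u \<inter> cnb n E G) \<le> t - 2" "card (nbr E u \<inter> cnb n E G) < t - 1"
    using neg u by (auto simp: rich_def)
  \<comment> \<open>The vertices that are not joined to \<open>G\<close>, are adjacent to
    \<open>u\<close> or are in reach of \<open>u\<close>; what remains of \<open>V2\<close> is
    far.\<close>
  define R where "R = ({..<n} - cnb n E G) \<union> (nbr E u \<inter> cnb n E G) \<union> reach E V1 U1 u"
  have fR: "finite R" by (simp add: R_def)
  have cR: "card R \<le> a + t + (t + a) * (L * t)"
  proof -
    have "nbr E u \<inter> V1 \<subseteq> (nbr E u \<inter> cnb n E G) \<union> ({..<n} - cnb n E G)" using V1 by auto
    then have "card (nbr E u \<inter> V1) \<le> card ((nbr E u \<inter> cnb n E G) \<union> ({..<n} - cnb n E G))" by (intro card_mono) auto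
    also have "\<dots> \<le> card (nbr E u \<inter> cnb n E G) + card ({..<n} - cnb n E G)" by (rule card_Un_le)
    also have "\<dots> \<le> t + a" using c G(3) by linarith
    finally have "card (reach E V1 U1 u) \<le> (t + a) * (L * t)"
      using U1 V1 by (intro card_reach) auto
    moreover have "card R \<le> card ({..<n} - cnb n E G) + card (nbr E u \<inter> cnb n E G) + card (reach E V1 U1 u)"
      unfolding R_def using card_Un_le[of "({..<n} - cnb n E G) \<union> (nbr E u \<inter> cnb n E G)" "reach E V1 U1 u"]
        card_Un_le[of "{..<n} - cnb n E G" "nbr E u \<inter> cnb n E G"] by linarith
    ultimately show ?thesis using c G(3) by linarith
  qed
  define V' where "V' = V2 - R"
  define P where "P = {x \<in> U1. s - 1 \<le> card (nbr E x \<inter> K)}"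
  have fin: "finite V2" "finite V'" "finite P"
  proof -
    have "V2 \<subseteq> {..<n}" using V1 V2 by blast
    then show "finite V2" by (rule finite_subset) simp
    then show "finite V'" by (simp add: V'_def)
    have "P \<subseteq> {..<n}" using U1 by (auto simp: P_def)
    then show "finite P" by (rule finite_subset) simp
  qed
  have many: "t - s \<le> card (nbr (E\<inverse>) v \<inter> P)" if v: "v \<in> V'" for v
  proof -
    have v2: "v \<in> V2" "v \<notin> nbr E u" "v \<notin> reach E V1 U1 u" "v \<in> cnb n E G"
      using v V1 V2 by (auto simp: V'_def R_def)
    have v1: "v < n" "v \<notin> K" "card (nbr (E\<inverse>) v \<inter> H) = s - 1" "nbr (E\<inverse>) v - H \<subseteq> U2"
      using V1[of v] V2[OF v2(1)] by auto
    have "G \<subseteq> nbr (E\<inverse>) v \<inter> H" using G(1) v2(4) by (auto simp: cnb_def)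
    then have GH: "nbr (E\<inverse>) v \<inter> H = G" using G(2) v1(3) by (intro card_seteq[symmetric]) auto
    obtain S T where ST: "S \<subseteq> nbr (E\<inverse>) v" "T \<subseteq> nbr E u" "S \<times> T \<subseteq> E"
        "card S = s - 1 \<and> card T = t - 1 \<or> card S = t - 1 \<and> card T = s - 1"
      using sat[OF u(1) v1(1)] v2(2) unfolding mem_nbr by blast
    have ge: "s - 1 \<le> card S" "s - 1 \<le> card T" "s - 1 < t - 1" using ST(4) s_pos s_less_t by auto
    have fS: "finite S" "finite T" using ST(1,2) by (auto intro: finite_subset[OF _ finite_nbr(1)] finite_subset[OF _ finite_nbr(2)])
    have "\<not> S \<subseteq> H"
    proof
      assume "S \<subseteq> H"
      then have "S \<subseteq> G" using ST(1) GH by blast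
      then have S: "S = G" using G(2) ge(1) GH finite_nbr(2)[of v]
        by (intro card_seteq) (auto intro: finite_subset)
      then have "card T = t - 1" using ST(4) G(2) ge(3) by auto
      moreover have "T \<subseteq> nbr E u \<inter> cnb n E G"
        using ST(2,3) nbr_lessThan(1)[of u] S by (auto simp: cnb_def)
      then have "card T \<le> card (nbr E u \<inter> cnb n E G)" by (intro card_mono) auto
      ultimately show False using c(2) by simp
    qed
    then obtain x0 where x0: "x0 \<in> S" "x0 \<notin> H" by blast
    have xU2: "x \<in> U2" if "x \<in> S" "x \<notin> H" for x using that ST(1) v1(4) by blast
    have TK: "T \<subseteq> K"
    proof
      fix w assume w: "w \<in> T"
      have xw: "(u, w) \<in> E" "(x0, v) \<in> E" "(x0, w) \<in> E" using ST(1-3) x0(1) w by auto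
      show "w \<in> K"
      proof (rule ccontr)
        assume "w \<notin> K"
        then have "w \<in> V1" using U2[OF xU2[OF x0]] xw(3) by auto
        moreover have "x0 \<in> U1" using U2[OF xU2[OF x0]] by simp
        ultimately show False using v2(3) reachI[of u w E V1 x0 U1 v] xw by simp
      qed
    qed
    \<comment> \<open>\<open>x0\<close> is adjacent to all of \<open>T\<close> and also to the low
      vertex \<open>v\<close>, so its degree \<open>t - 1\<close> exceeds the size of
      \<open>T\<close>. Hence \<open>S\<close> is the side with \<open>t - 1\<close> vertices, of
      which at most \<open>s - 1\<close> are high.\<close>
    have "card T < card (nbr E x0)"
    proof (rule psubset_card_mono)
      have "v \<in> nbr E x0" "v \<notin> T" using x0(1) ST(1) v1(2) TK by auto
      moreover have "T \<subseteq> nbr E x0" using ST(3) x0(1) by auto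
      ultimately show "T \<subset> nbr E x0" by blast
    qed simp
    then have "card T < t - 1" using U1[of x0] U2[OF xU2[OF x0]] by simp
    then have cST: "card S = t - 1" "card T = s - 1" using ST(4) by auto
    have "S - H \<subseteq> nbr (E\<inverse>) v \<inter> P"
    proof
      fix x assume x: "x \<in> S - H"
      have "T \<subseteq> nbr E x \<inter> K" using x ST(3) TK by auto
      then have "s - 1 \<le> card (nbr E x \<inter> K)" using cST(2) card_mono[of "nbr E x \<inter> K" T] by simp
      then show "x \<in> nbr (E\<inverse>) v \<inter> P" using x ST(1) xU2[of x] U2[of x] by (auto simp: P_def)
    qed
    then have "card (S - H) \<le> card (nbr (E\<inverse>) v \<inter> P)" by (intro card_mono) auto
    moreover have "card S = card (S \<inter> H) + card (S - H)"
      using card_Int_Diff[OF fS(1)] .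
    moreover have "card (S \<inter> H) \<le> card (nbr (E\<inverse>) v \<inter> H)" using ST(1) by (intro card_mono) auto
    ultimately show ?thesis using cST(1) v1(3) s_pos by linarith
  qed
  have few: "card (nbr E x \<inter> V') \<le> t - s" if x: "x \<in> P" for x
  proof -
    have "nbr E x \<inter> V' \<subseteq> nbr E x - K" using V1 V2 by (auto simp: V'_def)
    then have "card (nbr E x \<inter> V') \<le> card (nbr E x - K)" by (intro card_mono) auto
    moreover have "card (nbr E x) = card (nbr E x \<inter> K) + card (nbr E x - K)" by (rule card_Int_Diff) simp
    moreover have "card (nbr E x) = t - 1" "s - 1 \<le> card (nbr E x \<inter> K)" using x U1 by (auto simp: P_def)
    ultimately show ?thesis using s_pos s_less_t by linarith
  qed
  have "card V' * (t - s) \<le> (\<Sum>v\<in>V'. card (nbr (E\<inverse>) v \<inter> P))"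
    using sum_mono[of V' "\<lambda>_. t - s", OF many] by simp
  also have "\<dots> = (\<Sum>x\<in>P. card (nbr E x \<inter> V'))" using double_count[OF fin(3,2)] by simp
  also have "\<dots> \<le> card P * (t - s)" using sum_mono[of P _ "\<lambda>_. t - s", OF few] by simp
  finally have "card V' \<le> card P" using s_less_t by simp
  moreover have "card P + card (deficient n s E K) \<le> n"
  proof -
    have "card P + card (deficient n s E K) = card (P \<union> deficient n s E K)"
      using fin(3) by (intro card_Un_disjoint[symmetric]) (auto simp: P_def deficient_def)
    also have "\<dots> \<le> card {..<n}" using U1 by (intro card_mono) (auto simp: P_def deficient_def)
    finally show ?thesis by simp
  qed
  moreover have "card V2 \<le> card V' + card R"
  proof -
    have "card V2 \<le> card (V' \<union> R)" using fin fR by (intro card_mono) (auto simp: V'_def)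
    then show ?thesis using card_Un_le[of V' R] by simp
  qed
  ultimately show False using V2c big cR by linarith
qed

end

context dense_sat_graph
begin

lemmas card_meeting' = sat_graph.card_meeting[OF swap, unfolded converse_converse]
lemmas all_rich_bound' = dense_sat_graph.all_rich_bound[OF swap_dense, unfolded converse_converse card_inverse]

text \<open>A deficient vertex outside \<open>H\<close> makes the deficient vertices of the second
  class few, so that excess and abundance are at most \<open>a\<close>. After exceptional vertices
  are removed twice from each class, a deficient vertex still remains in \<open>U2\<close>; it
  provides \<open>G\<close>, and every vertex of the first class outside \<open>G\<close> is
  rich.\<close>

lemma unbalanced_bound:
  assumes H: "H \<subseteq> {..<n}" and e: "card E \<le> (s + t - 2) * n"
    and dH: "\<And>u. u < n \<Longrightarrow> u \<notin> H \<Longrightarrow> card (nbr E u) \<le> M"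
    and K: "K \<subseteq> {..<n}" and dK: "\<And>v. v < n \<Longrightarrow> v \<notin> K \<Longrightarrow> card (nbr (E\<inverse>) v) \<le> L" and L: "1 \<le> L"
    and a: "a = t * (card H + (M + M * (L * M)))"
    and big: "card H + card K + 3 * t ^ 2 * L * a + t ^ 2 * L + t + (t + t ^ 2 * L) * (L * t) < card (deficient n s E K)"
  shows "int (s + t - 2) * int n - int (s - 1) * int (t - 1) \<le> int (card E)"
proof -
  have t2: "2 \<le> t" using s_pos s_less_t by simp
  have fin: "finite H" "finite K" using H K finite_subset by blast+
  have "\<not> deficient n s E K \<subseteq> H" using big card_mono[OF fin(1), of "deficient n s E K"] by linarith
  then obtain u where "u \<in> deficient n s E K" "u \<notin> H" by blast
  then have c0: "card (deficient n s (E\<inverse>) H) \<le> M + M * (L * M)"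
    using deficient_converse_small[OF dH dK] by blast
  have "(t - 1) * card H + (s - 1) * card (deficient n s (E\<inverse>) H) \<le> t * card H + t * (M + M * (L * M))"
    using c0 s_less_t by (intro add_mono mult_mono) auto
  also have "\<dots> = a" by (simp add: a distrib_left)
  finally have ex: "excess n t E H + card (abundant n s (E\<inverse>) H) \<le> a" using excess_bound[OF H e] by linarith
  have "M + M * (L * M) \<le> t * (M + M * (L * M))" using t2 by simp
  then have un: "card (deficient n s (E\<inverse>) H) \<le> a" using c0 by (simp add: a distrib_left)

  \<comment> \<open>No condition on neighbours in \<open>K\<close> is imposed, since many vertices
    of this class are deficient. For the same reason the excess in the second class is not
    controlled, and \<open>V1\<close> has only the degree bound \<open>L\<close>.\<close>
  define U1 where "U1 = {u. u < n \<and> u \<notin> H \<and> card (nbr E u) = t - 1}"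
  define W1 where "W1 = {..<n} - H - U1"
  have "W1 \<subseteq> {u. u < n \<and> u \<notin> H \<and> t - 1 < card (nbr E u)}" using deg by (force simp: W1_def U1_def)
  then have "card W1 \<le> card {u. u < n \<and> u \<notin> H \<and> t - 1 < card (nbr E u)}" by (intro card_mono) auto
  then have W1: "card W1 \<le> a" using card_degree_ge_t_le[of H] ex by linarith
  have "(\<Sum>u\<in>W1. card (nbr E u)) \<le> excess n t E H + (t - 1) * card W1"
    by (rule sum_degree_le) (auto simp: W1_def)
  also have "\<dots> \<le> a + (t - 1) * a" using ex W1 by (intro add_mono mult_le_mono2) auto
  also have "\<dots> = t * a" using t2 by (cases t) auto
  finally have sW1: "(\<Sum>u\<in>W1. card (nbr E u)) \<le> t * a" .

  define V1 where "V1 = {v. v < n \<and> v \<notin> K \<and> card (nbr (E\<inverse>) v \<inter> H) = s - 1 \<and> nbr (E\<inverse>) v - H \<subseteq> U1}"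
  define X1 where "X1 = {..<n} - K - V1"
  define b where "b = 2 * t * a"
  have "X1 \<subseteq> abundant n s (E\<inverse>) H \<union> deficient n s (E\<inverse>) H \<union> {v \<in> {..<n}. nbr (E\<inverse>) v \<inter> W1 \<noteq> {}}"
  proof
    fix v assume v: "v \<in> X1"
    then have "v < n" "card (nbr (E\<inverse>) v \<inter> H) \<noteq> s - 1 \<or> \<not> nbr (E\<inverse>) v - H \<subseteq> U1"
      by (auto simp: X1_def V1_def)
    moreover have "nbr (E\<inverse>) v \<inter> W1 \<noteq> {}" if "\<not> nbr (E\<inverse>) v - H \<subseteq> U1"
      using that nbr_lessThan(2)[of v] unfolding W1_def by blast
    ultimately show "v \<in> abundant n s (E\<inverse>) H \<union> deficient n s (E\<inverse>) H \<union> {v \<in> {..<n}. nbr (E\<inverse>) v \<inter> W1 \<noteq> {}}"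
      unfolding abundant_def deficient_def by (cases "card (nbr (E\<inverse>) v \<inter> H) < s - 1") auto
  qed
  then have "card X1 \<le> card (abundant n s (E\<inverse>) H \<union> deficient n s (E\<inverse>) H \<union> {v \<in> {..<n}. nbr (E\<inverse>) v \<inter> W1 \<noteq> {}})"
    by (intro card_mono) auto
  also have "\<dots> \<le> card (abundant n s (E\<inverse>) H) + card (deficient n s (E\<inverse>) H) + card {v \<in> {..<n}. nbr (E\<inverse>) v \<inter> W1 \<noteq> {}}"
    using card_Un_le[of "abundant n s (E\<inverse>) H \<union> deficient n s (E\<inverse>) H" "{v \<in> {..<n}. nbr (E\<inverse>) v \<inter> W1 \<noteq> {}}"]
      card_Un_le[of "abundant n s (E\<inverse>) H" "deficient n s (E\<inverse>) H"] by linarith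
  also have "card {v \<in> {..<n}. nbr (E\<inverse>) v \<inter> W1 \<noteq> {}} \<le> (\<Sum>w\<in>W1. card (nbr E w))"
    by (rule card_meeting') (simp add: W1_def)
  finally have "card X1 \<le> a + a + t * a" using ex un sW1 by linarith
  moreover have "2 * a \<le> t * a" using t2 by (rule mult_le_mono1)
  moreover have "b = 2 * (t * a)" by (simp add: b_def)
  ultimately have X1: "card X1 \<le> b" by linarith
  have "(\<Sum>v\<in>X1. card (nbr (E\<inverse>) v)) \<le> (\<Sum>v\<in>X1. L)" using dK by (intro sum_mono) (auto simp: X1_def)
  also have "\<dots> \<le> b * L" using X1 by simp
  finally have sX1: "(\<Sum>v\<in>X1. card (nbr (E\<inverse>) v)) \<le> b * L" .

  define U2 where "U2 = {u \<in> U1. nbr E u - K \<subseteq> V1}"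
  have "U1 - U2 \<subseteq> {u \<in> {..<n}. nbr E u \<inter> X1 \<noteq> {}}"
  proof
    fix u assume u: "u \<in> U1 - U2"
    then have "\<not> nbr E u - K \<subseteq> V1" "u < n" by (auto simp: U2_def U1_def)
    then show "u \<in> {u \<in> {..<n}. nbr E u \<inter> X1 \<noteq> {}}"
      using nbr_lessThan(1)[of u] unfolding X1_def by blast
  qed
  then have "card (U1 - U2) \<le> card {u \<in> {..<n}. nbr E u \<inter> X1 \<noteq> {}}" by (intro card_mono) auto
  also have "\<dots> \<le> (\<Sum>w\<in>X1. card (nbr (E\<inverse>) w))" by (rule card_meeting) (simp add: X1_def)
  finally have U12: "card (U1 - U2) \<le> b * L" using sX1 by linarith
  have fU1: "finite U1" by (simp add: U1_def)
  define W2 where "W2 = {..<n} - H - U2"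
  have W2: "W2 = W1 \<union> (U1 - U2)" by (auto simp: W1_def W2_def U2_def U1_def)
  have "(\<Sum>u\<in>W2. card (nbr E u)) = (\<Sum>u\<in>W1. card (nbr E u)) + (\<Sum>u\<in>U1 - U2. card (nbr E u))"
    unfolding W2 using fU1 by (intro sum.union_disjoint) (auto simp: W1_def)
  also have "(\<Sum>u\<in>U1 - U2. card (nbr E u)) = (t - 1) * card (U1 - U2)"
    by (simp add: U1_def)
  also have "\<dots> \<le> (t - 1) * (b * L)" using U12 by (rule mult_le_mono2)
  finally have sW2: "(\<Sum>u\<in>W2. card (nbr E u)) \<le> t * a + (t - 1) * (b * L)" using sW1 by linarith

  define V2 where "V2 = {v \<in> V1. nbr (E\<inverse>) v - H \<subseteq> U2}"
  have "V1 - V2 \<subseteq> {v \<in> {..<n}. nbr (E\<inverse>) v \<inter> W2 \<noteq> {}}"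
  proof
    fix v assume v: "v \<in> V1 - V2"
    then have "\<not> nbr (E\<inverse>) v - H \<subseteq> U2" "v < n" by (auto simp: V2_def V1_def)
    then show "v \<in> {v \<in> {..<n}. nbr (E\<inverse>) v \<inter> W2 \<noteq> {}}"
      using nbr_lessThan(2)[of v] unfolding W2_def by blast
  qed
  then have "card (V1 - V2) \<le> card {v \<in> {..<n}. nbr (E\<inverse>) v \<inter> W2 \<noteq> {}}" by (intro card_mono) auto
  also have "\<dots> \<le> (\<Sum>w\<in>W2. card (nbr E w))" by (rule card_meeting') (simp add: W2_def)
  finally have V12: "card (V1 - V2) \<le> t * a + (t - 1) * (b * L)" using sW2 by linarith
  have fV: "finite V1" "finite V2" by (auto simp: V1_def V2_def)
  have "{..<n} \<subseteq> V2 \<union> (K \<union> (X1 \<union> (V1 - V2)))" by (auto simp: X1_def)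
  then have "card {..<n} \<le> card (V2 \<union> (K \<union> (X1 \<union> (V1 - V2))))"
    using fV fin by (intro card_mono) (auto simp: X1_def)
  then have n: "n \<le> card V2 + (card K + (card X1 + card (V1 - V2)))"
    using card_Un_le[of V2 "K \<union> (X1 \<union> (V1 - V2))"] card_Un_le[of K "X1 \<union> (V1 - V2)"] card_Un_le[of X1 "V1 - V2"]
    by simp
  have "t * a \<le> t * a * L" "t * a * L \<le> t * a * L * t" using L t2 by auto
  moreover have "(t - 1) * (b * L) + 2 * (t * a * L) = 2 * (t * a * L * t)"
    using t2 by (cases t) (auto simp: b_def algebra_simps)
  moreover have "3 * t ^ 2 * L * a = 3 * (t * a * L * t)" by (simp add: power2_eq_square algebra_simps)
  ultimately have d: "b + (t * a + (t - 1) * (b * L)) \<le> 3 * t ^ 2 * L * a" and d': "a + b * L \<le> 3 * t ^ 2 * L * a"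
  proof -
    assume *: "t * a \<le> t * a * L" "t * a * L \<le> t * a * L * t"
      "(t - 1) * (b * L) + 2 * (t * a * L) = 2 * (t * a * L * t)" "3 * t ^ 2 * L * a = 3 * (t * a * L * t)"
    have b: "b = 2 * (t * a)" by (simp add: b_def)
    show "b + (t * a + (t - 1) * (b * L)) \<le> 3 * t ^ 2 * L * a" using * b by linarith
    have "a \<le> t * a" using t2 by simp
    moreover have "b * L = 2 * (t * a * L)" by (simp add: b_def)
    ultimately show "a + b * L \<le> 3 * t ^ 2 * L * a" using * by linarith
  qed
  have nd: "n \<le> card V2 + (card K + 3 * t ^ 2 * L * a)" using n X1 V12 d by linarith

  have "\<not> deficient n s E K \<subseteq> H \<union> (W1 \<union> (U1 - U2))"
  proof
    assume "deficient n s E K \<subseteq> H \<union> (W1 \<union> (U1 - U2))"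
    then have "card (deficient n s E K) \<le> card (H \<union> (W1 \<union> (U1 - U2)))"
      using fin fU1 by (intro card_mono) (auto simp: W1_def)
    then have "card (deficient n s E K) \<le> card H + (a + b * L)"
      using card_Un_le[of H "W1 \<union> (U1 - U2)"] card_Un_le[of W1 "U1 - U2"] W1 U12 by linarith
    then show False using big d' by linarith
  qed
  then obtain u1 where u1: "u1 \<in> deficient n s E K" "u1 \<notin> H" "u1 \<notin> W1" "u1 \<notin> U1 - U2" by blast
  then have "u1 < n" by (simp add: deficient_def)
  then have u1U: "u1 \<in> U2" using u1 by (auto simp: W1_def)

  have pU1: "u < n \<and> card (nbr E u) = t - 1" if "u \<in> U1" for u using that by (simp add: U1_def)
  have pV1: "v < n \<and> v \<notin> K \<and> card (nbr (E\<inverse>) v) \<le> L \<and> card (nbr (E\<inverse>) v \<inter> H) = s - 1 \<and> nbr (E\<inverse>) v - H \<subseteq> U1"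
    if "v \<in> V1" for v using that dK by (simp add: V1_def)
  have pU2: "u \<in> U1 \<and> nbr E u - K \<subseteq> V1" if "u \<in> U2" for u using that by (simp add: U2_def)
  have pV2: "v \<in> V1 \<and> nbr (E\<inverse>) v - H \<subseteq> U2" if "v \<in> V2" for v using that by (simp add: V2_def)
  obtain G where G: "G \<subseteq> H" "G \<subseteq> {..<n}" "card G = s - 1" "card ({..<n} - cnb n E G) \<le> t ^ 2 * L"
    using almost_all_joined[of U1 V1 L H u1 K] pU1 pV1 u1(1) pU2[OF u1U] L by blast
  have big': "card K + 3 * t ^ 2 * L * a + t ^ 2 * L + t + (t + t ^ 2 * L) * (L * t) < card (deficient n s E K)"
    by (rule le_less_trans[OF _ big]) simp
  have "u \<in> rich n t (E\<inverse>) G" if "u < n" "u \<notin> G" for u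
    by (rule all_joined_or_rich[OF pU1 pV1 pU2 pV2 G(1,3,4) nd big' that])
  then show ?thesis using all_rich_bound'[OF G(2,3)] by blast
qed

end

subsection \<open>Choice of thresholds\<close>

definition large :: "nat \<Rightarrow> (nat \<times> nat) set \<Rightarrow> nat \<Rightarrow> nat set" where
  "large n E L = {u. u < n \<and> L \<le> card (nbr E u)}"

lemma large_lessThan: "large n E L \<subseteq> {..<n}"
  by (auto simp: large_def)

context dense_sat_graph
begin

lemma card_large: "L * card (large n E L) \<le> card E"
proof -
  have "L * card (large n E L) = (\<Sum>u\<in>large n E L. L)" by simp
  also have "\<dots> \<le> (\<Sum>u\<in>large n E L. card (nbr E u))" by (intro sum_mono) (auto simp: large_def)
  also have "\<dots> \<le> (\<Sum>u<n. card (nbr E u))" using large_lessThan by (intro sum_mono2) auto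
  finally show ?thesis using card_E by simp
qed

lemma card_large_le:
  assumes "card E \<le> (s + t - 2) * n" "L = 2 * t * r"
  shows "r * card (large n E L) \<le> n"
proof -
  have "L * card (large n E L) \<le> (s + t - 2) * n" using card_large assms(1) by (rule order_trans)
  also have "\<dots> \<le> 2 * t * n" using s_less_t by (intro mult_le_mono1) simp
  finally have "2 * t * (r * card (large n E L)) \<le> 2 * t * n" by (simp add: assms(2) mult.assoc)
  then show ?thesis using s_less_t by simp
qed

lemmas card_large_le' = dense_sat_graph.card_large_le[OF swap_dense, unfolded converse_converse card_inverse]

text \<open>\<open>M\<close> is chosen after \<open>L\<close> because the number \<open>h\<close> of
  vertices of degree at least \<open>M\<close> enters the size condition of
  \<open>unbalanced_bound\<close> with the factor \<open>3 * t ^ 3 * L\<close>. After multiplication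
  by \<open>p\<close>, the terms take at most the shares 1/16, 1/4, 3/16 and 1/4 of
  \<open>n\<close>.\<close>

lemma unbalanced_threshold_bound:
  assumes e: "card E \<le> (s + t - 2) * n" and L: "L = 8 * t * p" and M: "M = 32 * t ^ 4 * L * p" and p: "1 \<le> p"
    and n: "4 * p * (3 * t ^ 3 * L * (M + M * (L * M)) + t ^ 2 * L + t + (t + t ^ 2 * L) * (L * t)) \<le> n"
    and un: "n < p * card (deficient n s E (large n (E\<inverse>) L))"
  shows "int (s + t - 2) * int n - int (s - 1) * int (t - 1) \<le> int (card E)"
proof -
  define h where "h = card (large n E M)"
  define k where "k = card (large n (E\<inverse>) L)"
  define C where "C = M + M * (L * M)"
  define D where "D = t ^ 2 * L + t + (t + t ^ 2 * L) * (L * t)"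
  have t: "1 \<le> t" using s_less_t by simp
  have k: "4 * p * k \<le> n" unfolding k_def by (rule card_large_le'[OF e]) (simp add: L)
  have "16 * t ^ 3 * L * p * h \<le> n" unfolding h_def
    by (rule card_large_le[OF e]) (simp add: M power_numeral_reduce)
  then have h: "16 * (t ^ 3 * L * (p * h)) \<le> n" by (simp add: ac_simps)
  have "1 * 1 \<le> t ^ 3 * L" using t p by (intro mult_le_mono) (auto simp: L)
  then have ph: "p * h \<le> t ^ 3 * L * (p * h)" by simp
  have "p * (h + k + 3 * t ^ 3 * L * h + (3 * t ^ 3 * L * C + D)) =
      p * h + p * k + 3 * (t ^ 3 * L * (p * h)) + p * (3 * t ^ 3 * L * C + D)"
    by (simp add: algebra_simps)
  also have "\<dots> \<le> n"
  proof -
    have "4 * p * (3 * t ^ 3 * L * C + D) \<le> n" using n by (simp add: C_def D_def add.assoc)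
    then have "4 * (p * (3 * t ^ 3 * L * C + D)) \<le> n" by (simp only: mult.assoc)
    moreover have "4 * (p * k) \<le> n" using k by (simp only: mult.assoc)
    ultimately show ?thesis using h ph by linarith
  qed
  also note un
  finally have "h + k + 3 * t ^ 3 * L * h + (3 * t ^ 3 * L * C + D) < card (deficient n s E (large n (E\<inverse>) L))"
    by simp
  moreover have "3 * t ^ 2 * L * (t * (h + C)) = 3 * t ^ 3 * L * h + 3 * t ^ 3 * L * C"
    by (simp add: power_numeral_reduce algebra_simps)
  ultimately have big: "h + k + 3 * t ^ 2 * L * (t * (h + C)) + t ^ 2 * L + t + (t + t ^ 2 * L) * (L * t)
      < card (deficient n s E (large n (E\<inverse>) L))"
    by (simp add: D_def add.assoc)
  show ?thesis
  proof (rule unbalanced_bound[OF large_lessThan e _ large_lessThan _ _ refl])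
    show "card (nbr E u) \<le> M" if "u < n" "u \<notin> large n E M" for u using that by (simp add: large_def)
    show "card (nbr (E\<inverse>) v) \<le> L" if "v < n" "v \<notin> large n (E\<inverse>) L" for v using that by (simp add: large_def)
    show "1 \<le> L" using t p by (simp add: L)
    show "card (large n E M) + card (large n (E\<inverse>) L) +
        3 * t ^ 2 * L * (t * (card (large n E M) + (M + M * (L * M)))) + t ^ 2 * L + t +
        (t + t ^ 2 * L) * (L * t) < card (deficient n s E (large n (E\<inverse>) L))"
      using big unfolding h_def k_def C_def .
  qed
qed

lemmas unbalanced_threshold_bound' =
  dense_sat_graph.unbalanced_threshold_bound[OF swap_dense, unfolded converse_converse card_inverse]

text \<open>Either one class has more than \<open>n / p\<close> deficient vertices, or both have at
  most \<open>m = n div p\<close>. The value of \<open>p\<close> makes \<open>9 * t ^ 8 * m\<close>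
  at most 9/40 of \<open>n\<close>, and the remaining terms are below half of
  \<open>n\<close>.\<close>

lemma dense_bound:
  assumes e: "card E \<le> (s + t - 2) * n" and p: "p = 40 * t ^ 8" and L: "L = 8 * t * p" and M: "M = 32 * t ^ 4 * L * p"
    and n1: "4 * p * (3 * t ^ 3 * L * (M + M * (L * M)) + t ^ 2 * L + t + (t + t ^ 2 * L) * (L * t)) \<le> n"
    and n2: "2 * (2 ^ t * t ^ 4 + 2 * t ^ 9 + t ^ 6) < n"
  shows "int (s + t - 2) * int n - int (s - 1) * int (t - 1) - (int (s - 1))\<^sup>2 div 4 \<le> int (card E)"
proof -
  have p1: "1 \<le> p" using s_less_t by (simp add: p)
  have sq: "0 \<le> (int (s - 1))\<^sup>2 div 4" by (simp add: pos_imp_zdiv_nonneg_iff)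
  define H where "H = large n E L"
  define K where "K = large n (E\<inverse>) L"
  consider "n < p * card (deficient n s E K)" | "n < p * card (deficient n s (E\<inverse>) H)"
    | "p * card (deficient n s E K) \<le> n" "p * card (deficient n s (E\<inverse>) H) \<le> n" by linarith
  then show ?thesis
  proof cases
    case 1
    then show ?thesis using unbalanced_threshold_bound[OF e L M p1 n1] sq unfolding K_def by linarith
  next
    case 2
    then show ?thesis using unbalanced_threshold_bound'[OF e L M p1 n1] sq unfolding H_def by linarith
  next
    case 3
    define m where "m = n div p"
    have le_m: "x \<le> m" if "p * x \<le> n" for x
      using that p1 by (simp add: m_def less_eq_div_iff_mult_less_eq mult.commute)
    have "4 * p * card H \<le> n" "4 * p * card K \<le> n"
      unfolding H_def K_def by (rule card_large_le[OF e], simp add: L, rule card_large_le'[OF e], simp add: L)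
    then have "p * card H \<le> n" "p * card K \<le> n" by (simp_all only: mult.assoc)
    then have m: "card H \<le> m" "card K \<le> m" "card (deficient n s E K) \<le> m" "card (deficient n s (E\<inverse>) H) \<le> m"
      using 3 le_m by blast+
    have "p * m \<le> n" by (simp add: m_def)
    then have "40 * (t ^ 8 * m) \<le> n" by (simp add: p)
    moreover have "q + 9 * x < n" if "40 * x \<le> n" "2 * q < n" for q x using that by linarith
    ultimately have "2 ^ t * t ^ 4 + 2 * t ^ 9 + t ^ 6 + 9 * (t ^ 8 * m) < n" using n2 by blast
    then have "2 ^ t * t ^ 4 + 2 * t ^ 9 + t ^ 6 + 9 * t ^ 8 * m < n" by (simp only: mult.assoc)
    then show ?thesis
      using balanced_bound[OF _ _ e m] large_lessThan unfolding H_def K_def by blast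
  qed
qed

end

section \<open>Transfer to saturated graphs and the final bound\<close>

text \<open>Since \<open>E\<close> contains no copy, the copy created by adding
  \<open>(u, v)\<close> uses this edge; removing its ends leaves \<open>S\<close> and
  \<open>T\<close>.\<close>

lemma Kst_saturated_sat_graph:
  assumes sat: "Kst_saturated n s t E" and st: "1 \<le> s" "s < t"
  shows "sat_graph n s t E"
proof
  show sub: "E \<subseteq> {..<n} \<times> {..<n}"
    using sat by (simp add: Kst_saturated_def bip_graph_def lessThan_atLeast0)
  show "1 \<le> s" "s < t" by fact+
  fix u v assume uv: "u < n" "v < n" "(u, v) \<notin> E"
  then have "contains_Kst n s t (insert (u, v) E)" using sat by (simp add: Kst_saturated_def)
  then obtain A B where AB: "A \<subseteq> {0..<n}" "B \<subseteq> {0..<n}" "A \<times> B \<subseteq> insert (u, v) E"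
    and card: "(card A = s \<and> card B = t) \<or> (card A = t \<and> card B = s)"
    unfolding contains_Kst_def by blast
  have "\<not> A \<times> B \<subseteq> E" using sat AB(1,2) card unfolding Kst_saturated_def contains_Kst_def by blast
  then have uA: "u \<in> A" "v \<in> B" using AB(3) by auto
  have fin: "finite A" "finite B" using AB(1,2) finite_subset by blast+
  have "A - {u} \<subseteq> nbr (E\<inverse>) v" "B - {v} \<subseteq> nbr E u" "(A - {u}) \<times> (B - {v}) \<subseteq> E"
    using AB(3) uA by auto
  moreover have "card (A - {u}) = s - 1 \<and> card (B - {v}) = t - 1 \<or> card (A - {u}) = t - 1 \<and> card (B - {v}) = s - 1"
    unfolding card_Diff_singleton[OF uA(1)] card_Diff_singleton[OF uA(2)] using card by blast
  ultimately show "\<exists>S T. S \<subseteq> nbr (E\<inverse>) v \<and> T \<subseteq> nbr E u \<and> S \<times> T \<subseteq> E \<and>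
      (card S = s - 1 \<and> card T = t - 1 \<or> card S = t - 1 \<and> card T = s - 1)" by blast
qed

text \<open>An infimum of naturals over the empty set would make \<open>sat_bip\<close> meaningless
  as a minimum. A maximal edge set without a copy is saturated.\<close>

lemma Kst_saturated_exists:
  assumes "1 \<le> s" "1 \<le> t"
  shows "\<exists>E. Kst_saturated n s t E"
proof -
  define \<F> where "\<F> = {E. E \<subseteq> {0..<n} \<times> {0..<n} \<and> \<not> contains_Kst n s t E}"
  have "finite \<F>" by (rule finite_subset[of _ "Pow ({0..<n} \<times> {0..<n})"]) (auto simp: \<F>_def)
  moreover have "\<not> contains_Kst n s t {}"
  proof
    assume "contains_Kst n s t {}"
    then obtain A B :: "nat set" where "A \<times> B \<subseteq> {}" "card A \<ge> 1" "card B \<ge> 1"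
      using assms unfolding contains_Kst_def by force
    then show False by (cases "A = {}"; cases "B = {}") auto
  qed
  then have "\<F> \<noteq> {}" by (auto simp: \<F>_def)
  ultimately obtain E where E: "E \<in> \<F>" "\<forall>E'\<in>\<F>. E \<subseteq> E' \<longrightarrow> E = E'"
    using finite_has_maximal[of \<F>] by blast
  have "contains_Kst n s t (insert (u, v) E)" if "u \<in> {0..<n}" "v \<in> {0..<n}" "(u, v) \<notin> E" for u v
  proof (rule ccontr)
    assume "\<not> contains_Kst n s t (insert (u, v) E)"
    then have "insert (u, v) E \<in> \<F>" using E(1) that(1,2) by (simp add: \<F>_def)
    then have "E = insert (u, v) E" using E(2) by blast
    then show False using that(3) by blast
  qed
  moreover have "bip_graph n E" "\<not> contains_Kst n s t E" using E(1) by (simp_all add: \<F>_def bip_graph_def)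
  ultimately have "Kst_saturated n s t E" by (simp add: Kst_saturated_def)
  then show ?thesis by (rule exI)
qed

theorem theorem1p3:
  fixes s t :: nat
  assumes "1 \<le> s" and "s < t"
  shows "\<exists>N. \<forall>n \<ge> N. int (sat_bip n s t) \<ge>
           int (s + t - 2) * int n - int (t - 1) * int (t - 2) - ((int s - 1)^2 div 4)"
proof -
  define p where "p = 40 * t ^ 8"
  define L where "L = 8 * t * p"
  define M where "M = 32 * t ^ 4 * L * p"
  define N1 where "N1 = 4 * p * (3 * t ^ 3 * L * (M + M * (L * M)) + t ^ 2 * L + t + (t + t ^ 2 * L) * (L * t))"
  define N2 where "N2 = 2 * (2 ^ t * t ^ 4 + 2 * t ^ 9 + t ^ 6)"
  have sq: "0 \<le> (int s - 1)\<^sup>2 div 4" by (simp add: pos_imp_zdiv_nonneg_iff)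
  \<comment> \<open>The constant of the dense case is at least as good as the stated one, because
    \<open>s - 1 \<le> t - 2\<close>.\<close>
  have "int (s - 1) * int (t - 1) \<le> int (t - 2) * int (t - 1)"
    using assms by (intro mult_right_mono) auto
  then have st: "int (s - 1) * int (t - 1) \<le> int (t - 1) * int (t - 2)" by (simp only: mult.commute)
  have "int (s + t - 2) * int n - int (t - 1) * int (t - 2) - ((int s - 1)\<^sup>2 div 4) \<le> int (sat_bip n s t)"
    if n: "N1 + N2 + s < n" for n
  proof -
    have "sat_bip n s t \<in> card ` {E. Kst_saturated n s t E}"
      unfolding sat_bip_def using Kst_saturated_exists[of s t n] assms by (intro Inf_nat_def1) auto
    then obtain E where E: "Kst_saturated n s t E" "sat_bip n s t = card E" by blast
    interpret sat_graph n s t E by (rule Kst_saturated_sat_graph[OF E(1) assms])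
    have low: ?thesis if "(s + t - 2) * n \<le> card E + (t - 1) * (t - 2)"
    proof -
      have "int ((s + t - 2) * n) \<le> int (card E + (t - 1) * (t - 2))" using that by (simp only: of_nat_le_iff)
      then show ?thesis using sq E(2) by (simp only: of_nat_add of_nat_mult)
    qed
    have n': "s - 1 \<le> n" "2 \<le> t" "N1 \<le> n" "N2 < n" using n assms by linarith+
    \<comment> \<open>Graphs with at least \<open>(s + t - 2) * n\<close> edges satisfy the bound at
      once; the dense case needs the opposite inequality to limit the vertices of high
      degree.\<close>
    consider u where "u < n" "card (nbr E u) \<le> t - 2" | v where "v < n" "card (nbr (E\<inverse>) v) \<le> t - 2"
      | "(s + t - 2) * n \<le> card E"
      | "\<forall>u<n. t - 1 \<le> card (nbr E u)" "\<forall>v<n. t - 1 \<le> card (nbr (E\<inverse>) v)" "card E \<le> (s + t - 2) * n"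
    proof -
      have "t - 1 \<le> x" if "\<not> x \<le> t - 2" for x using that n'(2) by linarith
      then show ?thesis using that using nle_le by blast
    qed
    then show ?thesis
    proof cases
      case 1
      then show ?thesis by (intro low low_degree_bound n')
    next
      case 2
      then have "(s + t - 2) * n \<le> card (E\<inverse>) + (t - 1) * (t - 2)"
        by (intro sat_graph.low_degree_bound[OF swap] n')
      then show ?thesis by (intro low) (simp only: card_inverse)
    next
      case 3
      then show ?thesis by (intro low trans_le_add1)
    next
      case 4
      then interpret dense_sat_graph n s t E by unfold_locales blast+
      have "int (s + t - 2) * int n - int (s - 1) * int (t - 1) - (int (s - 1))\<^sup>2 div 4 \<le> int (card E)"
        by (rule dense_bound[OF 4(3) p_def L_def M_def n'(3)[unfolded N1_def] n'(4)[unfolded N2_def]])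
      moreover have "(int (s - 1))\<^sup>2 = (int s - 1)\<^sup>2" using assms by (simp only: of_nat_diff of_nat_1)
      ultimately show ?thesis unfolding E(2) using st by linarith
    qed
  qed
  then show ?thesis using Suc_le_lessD by blast
qed

end
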